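(* Let $G=(V,E)$ be a finite hypergraph, $\mathcal{H}_V=\bigotimes_{v\in V}\mathcal{H}_v$ with $\mathcal{H}_v=\mathbb{C}^d$, and let $H=\sum_{A\in E}h_A$ be a finite-range Hamiltonian, where each $h_A$ is self-adjoint, supported on the hyperedge $A$, with $\|h_A\|\le1$, and the $h_A$ commute pairwise. For $\beta>0$ let $\omega=e^{-\beta H}/\mathrm{Tr}(e^{-\beta H})$, and let $\mathcal{L}_V=\sum_{v\in V}(\Psi_v-\mathrm{id})$ be the generator of the heat-bath dynamics. Then there exists an inverse temperature $\beta_c>0$ such that for any $\beta<\beta_c$ there is a constant $\kappa(\beta)<1$ such that for all $x\in\mathcal{B}(\mathcal{H}_V)$ and all $t\ge0$, $$\|e^{t\mathcal{L}_V}(x)\|_L\le e^{-(1-\kappa(\beta))t}\,\|x\|_L,\qquad \|x\|_L:=\max_{v\in V}\|x-\tau_v(x)\| .$$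
   Context: For $v\in V$, $v^c=V\setminus\{v\}$, $\mathrm{Tr}_v$ is the partial trace over site $v$, $\omega_{v^c}=\mathrm{Tr}_v(\omega)$, and $\tau_v(x)=\mathrm{Tr}_v(x)\otimes\frac{1_v}{d}$. The map $\Psi_v$ is $\Psi_v(x)=\omega_{v^c}^{-1/2}\,\mathrm{Tr}_v(\omega^{1/2}x\,\omega^{1/2})\,\omega_{v^c}^{-1/2}\otimes 1_v$, the Heisenberg-picture dual of $\Psi_v^\dagger(\rho)=\omega^{1/2}(\omega_{v^c}^{-1/2}\mathrm{Tr}_v(\rho)\omega_{v^c}^{-1/2}\otimes 1_v)\omega^{1/2}$ (partial trace followed by the Petz recovery map). Finite range: the size and diameter of hyperedges are bounded by a uniform constant. $\|\cdot\|$ is the operator norm. *)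

theory Defs
  imports "HOL-Analysis.Analysis" "HOL-Library.Function_Algebras"
begin

section \<open>Operators on a finite-dimensional Hilbert space with a fixed orthonormal basis\<close>

text \<open>
  The Hilbert space of a finite set of sites varies inside the statement, so it cannot be a type.
  For a finite set \<open>B\<close> of basis labels, an operator on the Hilbert space with orthonormal
  basis \<open>B\<close> is its array of matrix elements \<open>x s t\<close> (row \<open>s\<close>, column \<open>t\<close>), required to vanish
  outside \<open>B \<times> B\<close>.  Sums and differences of operators are the pointwise ones.  Pointwise
  \<open>*\<close> on functions is never meant as an operator product: the product is \<open>op_mult\<close>.
\<close>

type_synonym 'b opr = "'b \<Rightarrow> 'b \<Rightarrow> complex"

definition operators :: "'b set \<Rightarrow> 'b opr set" where
  "operators B = {x. \<forall>s t. x s t \<noteq> 0 \<longrightarrow> s \<in> B \<and> t \<in> B}"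

definition op_id :: "'b set \<Rightarrow> 'b opr" where
  "op_id B = (\<lambda>s t. if s \<in> B \<and> s = t then 1 else 0)"

definition op_scale :: "complex \<Rightarrow> 'b opr \<Rightarrow> 'b opr" where
  "op_scale c x = (\<lambda>s t. c * x s t)"

definition op_mult :: "'b set \<Rightarrow> 'b opr \<Rightarrow> 'b opr \<Rightarrow> 'b opr" where
  "op_mult B x y = (\<lambda>s t. \<Sum>u\<in>B. x s u * y u t)"

definition op_trace :: "'b set \<Rightarrow> 'b opr \<Rightarrow> complex" where
  "op_trace B x = (\<Sum>s\<in>B. x s s)"

definition op_apply :: "'b set \<Rightarrow> 'b opr \<Rightarrow> ('b \<Rightarrow> complex) \<Rightarrow> ('b \<Rightarrow> complex)" where
  "op_apply B x \<psi> = (\<lambda>s. \<Sum>t\<in>B. x s t * \<psi> t)"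

definition vec_norm :: "'b set \<Rightarrow> ('b \<Rightarrow> complex) \<Rightarrow> real" where
  "vec_norm B \<psi> = L2_set (\<lambda>s. cmod (\<psi> s)) B"

definition op_norm :: "'b set \<Rightarrow> 'b opr \<Rightarrow> real" where
  "op_norm B x = (SUP \<psi>\<in>{\<psi>. vec_norm B \<psi> \<le> 1}. vec_norm B (op_apply B x \<psi>))"

definition self_adjoint :: "'b opr \<Rightarrow> bool" where
  "self_adjoint x \<longleftrightarrow> (\<forall>s t. x s t = cnj (x t s))"

definition positive_semidef :: "'b set \<Rightarrow> 'b opr \<Rightarrow> bool" where
  "positive_semidef B x \<longleftrightarrow>
     self_adjoint x \<and> (\<forall>\<psi>. 0 \<le> Re (\<Sum>s\<in>B. cnj (\<psi> s) * op_apply B x \<psi> s))"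

text \<open>
  The two definite descriptions below denote the positive square root of a positive semidefinite
  operator and the inverse of an invertible one; they are only applied to positive definite
  operators.
\<close>

definition op_sqrt :: "'b set \<Rightarrow> 'b opr \<Rightarrow> 'b opr" where
  "op_sqrt B x = (THE y. y \<in> operators B \<and> positive_semidef B y \<and> op_mult B y y = x)"

definition op_inverse :: "'b set \<Rightarrow> 'b opr \<Rightarrow> 'b opr" where
  "op_inverse B x =
     (THE y. y \<in> operators B \<and> op_mult B x y = op_id B \<and> op_mult B y x = op_id B)"

text \<open>
  Exponentials of operators and of linear maps on operators are exponential series.  Convergence is
  taken entrywise, which in finite dimension is convergence in any norm.
\<close>

definition op_exp :: "'b set \<Rightarrow> 'b opr \<Rightarrow> 'b opr" where
  "op_exp B x = (\<lambda>s t. \<Sum>n. ((op_mult B x ^^ n) (op_id B)) s t / fact n)"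

definition superop_exp :: "real \<Rightarrow> ('b opr \<Rightarrow> 'b opr) \<Rightarrow> 'b opr \<Rightarrow> 'b opr" where
  "superop_exp \<theta> L x = (\<lambda>s t. \<Sum>n. complex_of_real (\<theta> ^ n / fact n) * (L ^^ n) x s t)"


section \<open>Quantum spin systems\<close>

text \<open>
  The product basis of the tensor product over the sites in \<open>V\<close> of copies of the \<open>d\<close>-dimensional
  space is labelled by the configurations \<open>V \<rightarrow> {0, \<dots>, d - 1}\<close>.
\<close>

definition configs :: "'v set \<Rightarrow> nat \<Rightarrow> ('v \<Rightarrow> nat) set" where
  "configs V d = (V \<rightarrow>\<^sub>E {..<d})"

text \<open>For \<open>A \<subseteq> V\<close> and \<open>k\<close> an operator on \<open>A\<close>: the operator \<open>k \<otimes> 1\<close> on \<open>V\<close>, with the identity on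
  \<open>V - A\<close>.\<close>

definition tensor_id :: "'v set \<Rightarrow> nat \<Rightarrow> 'v set \<Rightarrow> ('v \<Rightarrow> nat) opr \<Rightarrow> ('v \<Rightarrow> nat) opr" where
  "tensor_id V d A k = (\<lambda>s t.
     if s \<in> configs V d \<and> t \<in> configs V d \<and> (\<forall>u\<in>V - A. s u = t u)
     then k (restrict s A) (restrict t A) else 0)"

definition supported_on :: "'v set \<Rightarrow> nat \<Rightarrow> 'v set \<Rightarrow> ('v \<Rightarrow> nat) opr \<Rightarrow> bool" where
  "supported_on V d A x \<longleftrightarrow> (\<exists>k\<in>operators (configs A d). x = tensor_id V d A k)"

definition partial_trace :: "'v set \<Rightarrow> nat \<Rightarrow> 'v \<Rightarrow> ('v \<Rightarrow> nat) opr \<Rightarrow> ('v \<Rightarrow> nat) opr" where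
  "partial_trace V d v x = (\<lambda>s t.
     if s \<in> configs (V - {v}) d \<and> t \<in> configs (V - {v}) d
     then \<Sum>a<d. x (s(v := a)) (t(v := a)) else 0)"

definition tau :: "'v set \<Rightarrow> nat \<Rightarrow> 'v \<Rightarrow> ('v \<Rightarrow> nat) opr \<Rightarrow> ('v \<Rightarrow> nat) opr" where
  "tau V d v x = op_scale (1 / of_nat d) (tensor_id V d (V - {v}) (partial_trace V d v x))"

definition lipschitz_norm :: "'v set \<Rightarrow> nat \<Rightarrow> ('v \<Rightarrow> nat) opr \<Rightarrow> real" where
  "lipschitz_norm V d x = Max ((\<lambda>v. op_norm (configs V d) (x - tau V d v x)) ` V)"

definition gibbs_state :: "'v set \<Rightarrow> nat \<Rightarrow> ('v \<Rightarrow> nat) opr \<Rightarrow> real \<Rightarrow> ('v \<Rightarrow> nat) opr" where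
  "gibbs_state V d H \<beta> =
     (let e = op_exp (configs V d) (op_scale (- complex_of_real \<beta>) H)
      in op_scale (1 / op_trace (configs V d) e) e)"

definition heat_bath_map ::
    "'v set \<Rightarrow> nat \<Rightarrow> ('v \<Rightarrow> nat) opr \<Rightarrow> 'v \<Rightarrow> ('v \<Rightarrow> nat) opr \<Rightarrow> ('v \<Rightarrow> nat) opr" where
  "heat_bath_map V d \<omega> v x =
     (let B = configs V d;
          C = configs (V - {v}) d;
          r = op_sqrt B \<omega>;
          q = op_inverse C (op_sqrt C (partial_trace V d v \<omega>))
      in tensor_id V d (V - {v})
           (op_mult C (op_mult C q (partial_trace V d v (op_mult B (op_mult B r x) r))) q))"

definition heat_bath_generator ::
    "'v set \<Rightarrow> nat \<Rightarrow> ('v \<Rightarrow> nat) opr \<Rightarrow> ('v \<Rightarrow> nat) opr \<Rightarrow> ('v \<Rightarrow> nat) opr" where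
  "heat_bath_generator V d \<omega> x = (\<Sum>v\<in>V. heat_bath_map V d \<omega> v x - x)"


section \<open>Finite-range commuting Hamiltonians\<close>

definition finite_hypergraph :: "'v set \<Rightarrow> 'v set set \<Rightarrow> bool" where
  "finite_hypergraph V E \<longleftrightarrow> finite V \<and> V \<noteq> {} \<and> E \<subseteq> Pow V"

text \<open>
  Size and diameter of the hyperedges are at most \<open>R\<close>.  The diameter refers to a metric \<open>\<delta>\<close> on the
  sites (for instance a lattice distance).  Bounds that do not depend on the number of sites also
  need \<open>\<delta>\<close> to be of bounded growth at the scale of the interaction: balls of radius \<open>R\<close> contain at
  most \<open>N\<close> sites.  For a lattice this is automatic, and each finite hypergraph with a metric
  satisfies all three conditions for some \<open>R\<close> and \<open>N\<close>.
\<close>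

definition finite_range ::
    "'v set \<Rightarrow> 'v set set \<Rightarrow> ('v \<Rightarrow> 'v \<Rightarrow> real) \<Rightarrow> nat \<Rightarrow> nat \<Rightarrow> bool" where
  "finite_range V E \<delta> R N \<longleftrightarrow>
     Metric_space V \<delta> \<and>
     (\<forall>A\<in>E. card A \<le> R \<and> (\<forall>u\<in>A. \<forall>w\<in>A. \<delta> u w \<le> real R)) \<and>
     (\<forall>v\<in>V. card (Metric_space.mcball V \<delta> v (real R)) \<le> N)"

definition commuting_interaction ::
    "'v set \<Rightarrow> 'v set set \<Rightarrow> nat \<Rightarrow> ('v set \<Rightarrow> ('v \<Rightarrow> nat) opr) \<Rightarrow> bool" where
  "commuting_interaction V E d h \<longleftrightarrow>
     (\<forall>A\<in>E. self_adjoint (h A) \<and> supported_on V d A (h A) \<and> op_norm (configs V d) (h A) \<le> 1) \<and>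
     (\<forall>A\<in>E. \<forall>A'\<in>E. op_mult (configs V d) (h A) (h A') = op_mult (configs V d) (h A') (h A))"

end

theory Submission
  imports Defs
begin

text \<open>
  Let \<open>H\<^sub>v\<close> be the sum of the interaction terms touching \<open>v\<close>.  Since the terms commute, everything
  else cancels from the heat-bath map: \<open>\<Psi>\<^sub>v(x) = G \<tau>\<^sub>v(E x E) G\<close> with \<open>E = exp(- \<beta> H\<^sub>v / 2)\<close> and
  \<open>G = \<tau>\<^sub>v(E\<^sup>2)\<close> to the power \<open>-1/2\<close>.  This is a unital Kraus map, hence a contraction; it commutes
  with \<open>\<tau>\<^sub>u\<close> when \<open>u\<close> is far from \<open>v\<close>, fixes operators that act trivially near \<open>v\<close>, and differs from
  \<open>\<tau>\<^sub>v\<close> by at most \<open>\<epsilon>(\<beta>) \<rightarrow> 0\<close> in norm.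

  Put \<open>S = \<Sum>\<^sub>v \<Psi>\<^sub>v\<close> and \<open>M = |V|\<close>.  In \<open>(1 - \<tau>\<^sub>u) S x\<close> the term \<open>v = u\<close> vanishes, a far \<open>v\<close> contributes
  at most \<open>\<parallel>x\<parallel>\<^sub>L\<close>, and each of the at most \<open>N\<close> near \<open>v\<close> contributes at most \<open>(1 + 2 N \<epsilon>) \<parallel>x\<parallel>\<^sub>L\<close>: replace
  \<open>\<Psi>\<^sub>v\<close> by \<open>\<tau>\<^sub>v\<close> and subtract from \<open>x\<close> its average over the sites near \<open>v\<close>, which both maps fix.
  So \<open>\<parallel>S x\<parallel>\<^sub>L \<le> (M - 1 + \<kappa>) \<parallel>x\<parallel>\<^sub>L\<close> with \<open>\<kappa> = 2 N\<^sup>2 \<epsilon>\<close>, and summing the series for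
  \<open>exp(t (S - M)) = exp(- t M) exp(t S)\<close> gives the rate \<open>1 - \<kappa>\<close>.
\<close>

section \<open>Operators in a fixed finite basis\<close>

lemma sum_fun_apply: "(\<Sum>i\<in>I. f i) x = (\<Sum>i\<in>I. f i x)"
  by (induction I rule: infinite_finite_induct) auto

section \<open>Adjoints, inner products and linear operations on arrays of matrix elements\<close>

definition adj :: "'b opr \<Rightarrow> 'b opr" where
  "adj x = (\<lambda>s t. cnj (x t s))"

definition inner_on :: "'b set \<Rightarrow> ('b \<Rightarrow> complex) \<Rightarrow> ('b \<Rightarrow> complex) \<Rightarrow> complex" where
  "inner_on B \<phi> \<psi> = (\<Sum>s\<in>B. cnj (\<phi> s) * \<psi> s)"

lemma self_adjoint_iff_adj: "self_adjoint x \<longleftrightarrow> adj x = x"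
  unfolding self_adjoint_def adj_def by (metis (full_types) ext)

lemma adj_scale: "adj (op_scale c x) = op_scale (cnj c) (adj x)"
  by (simp add: adj_def op_scale_def)

lemma adj_diff: "adj (x - y) = adj x - adj y"
  by (intro ext) (simp add: adj_def)

lemma adj_sum: "adj (\<Sum>i\<in>I. f i) = (\<Sum>i\<in>I. adj (f i))"
  by (intro ext) (simp add: adj_def sum_fun_apply)

lemma adj_id [simp]: "adj (op_id B) = op_id B"
  by (intro ext) (auto simp: adj_def op_id_def)

lemma op_scale_one [simp]: "op_scale 1 x = x"
  by (simp add: op_scale_def)

lemma op_scale_scale [simp]: "op_scale a (op_scale b x) = op_scale (a * b) x"
  by (simp add: op_scale_def mult.assoc)

lemma op_scale_add: "op_scale a (x + y) = op_scale a x + op_scale a y"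
  by (intro ext) (simp add: op_scale_def algebra_simps)

lemma op_scale_diff: "op_scale a (x - y) = op_scale a x - op_scale a y"
  by (intro ext) (simp add: op_scale_def algebra_simps)

lemma op_scale_sum: "op_scale a (\<Sum>i\<in>I. f i) = (\<Sum>i\<in>I. op_scale a (f i))"
  by (intro ext) (simp add: op_scale_def sum_fun_apply sum_distrib_left)

lemma operators_zero [simp]: "0 \<in> operators B"
  by (simp add: operators_def)

lemma operators_add [simp]: "x \<in> operators B \<Longrightarrow> y \<in> operators B \<Longrightarrow> x + y \<in> operators B"
  by (auto simp: operators_def) (metis add_0)+

lemma operators_diff [simp]: "x \<in> operators B \<Longrightarrow> y \<in> operators B \<Longrightarrow> x - y \<in> operators B"
  by (auto simp: operators_def) (metis diff_zero)+

lemma operators_scale [simp]: "x \<in> operators B \<Longrightarrow> op_scale c x \<in> operators B"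
  by (auto simp: operators_def op_scale_def)

lemma operators_id [simp]: "op_id B \<in> operators B"
  by (auto simp: operators_def op_id_def split: if_splits)

lemma operators_adj [simp]: "adj x \<in> operators B \<longleftrightarrow> x \<in> operators B"
  by (auto simp: operators_def adj_def)

lemma operators_sum [simp]: "(\<And>i. i \<in> I \<Longrightarrow> f i \<in> operators B) \<Longrightarrow> (\<Sum>i\<in>I. f i) \<in> operators B"
  by (induction I rule: infinite_finite_induct) auto

lemma operators_mult [simp]:
  "x \<in> operators B \<Longrightarrow> y \<in> operators B \<Longrightarrow> op_mult B x y \<in> operators B"
  by (auto simp: operators_def op_mult_def elim!: sum.not_neutral_contains_not_neutral)

lemma operators_outside: "x \<in> operators B \<Longrightarrow> \<not> (s \<in> B \<and> t \<in> B) \<Longrightarrow> x s t = 0"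
  by (auto simp: operators_def)

lemma operators_eqI:
  assumes "x \<in> operators B" "y \<in> operators B" "\<And>s t. s \<in> B \<Longrightarrow> t \<in> B \<Longrightarrow> x s t = y s t"
  shows "x = y"
proof (intro ext)
  fix s t show "x s t = y s t"
    using assms operators_outside[of x B s t] operators_outside[of y B s t]
    by (cases "s \<in> B \<and> t \<in> B") auto
qed

text \<open>Binomial theorem for two commuting operations, in scalar form: think of
  \<open>W n k j\<close> as an entry after k uses of the first operation and j of the second, with n
  uses of their sum still pending. It serves both the powers of a sum of commuting operators and the
  iterates of a superoperator shifted by a scalar.\<close>

lemma binomial_expansion_of_recurrence:
  fixes W :: "nat \<Rightarrow> nat \<Rightarrow> nat \<Rightarrow> complex"
  assumes "\<And>n k j. W (Suc n) k j = W n (Suc k) j + W n k (Suc j)"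
  shows "W n k j = (\<Sum>i\<le>n. of_nat (n choose i) * W 0 (k + i) (j + (n - i)))"
proof (induction n arbitrary: k j)
  case (Suc n)
  have "W (Suc n) k j =
      (\<Sum>i\<le>n. of_nat (n choose i) * W 0 (k + Suc i) (j + (n - i))) +
      (\<Sum>i\<le>n. of_nat (n choose i) * W 0 (k + i) (j + Suc (n - i)))"
    by (simp add: assms Suc.IH)
  \<comment> \<open>Enlarging the range to \<open>Suc n\<close> adds a term with coefficient
    \<open>n choose Suc n\<close>, which is 0. After splitting off the first term, Pascal's rule
    merges the two sums.\<close>
  also have "(\<Sum>i\<le>n. of_nat (n choose i) * W 0 (k + i) (j + Suc (n - i))) =
      (\<Sum>i\<le>Suc n. of_nat (n choose i) * W 0 (k + i) (j + (Suc n - i)))"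
    by (simp add: Suc_diff_le)
  also have "\<dots> = W 0 k (j + Suc n) +
      (\<Sum>i\<le>n. of_nat (n choose Suc i) * W 0 (k + Suc i) (j + (n - i)))"
    by (subst sum.atMost_Suc_shift) simp
  finally show ?case
    by (subst sum.atMost_Suc_shift) (simp add: sum.distrib algebra_simps)
qed simp

locale fin_basis =
  fixes B :: "'b set"
  assumes finite_basis: "finite B"
begin

abbreviation mult :: "'b opr \<Rightarrow> 'b opr \<Rightarrow> 'b opr" (infixl "\<odot>" 70) where
  "x \<odot> y \<equiv> op_mult B x y"

abbreviation Id :: "'b opr" where "Id \<equiv> op_id B"

abbreviation ops :: "'b opr set" where "ops \<equiv> operators B"

abbreviation nrm :: "'b opr \<Rightarrow> real" where "nrm \<equiv> op_norm B"

section \<open>Algebra of the operator product, action on vectors, trace\<close>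

lemma mult_assoc: "x \<odot> y \<odot> z = x \<odot> (y \<odot> z)"
  unfolding op_mult_def sum_distrib_left sum_distrib_right
  by (intro ext, subst sum.swap) (simp add: mult.assoc)

lemma mult_add_left: "(x + y) \<odot> z = x \<odot> z + y \<odot> z"
  by (intro ext) (simp add: op_mult_def algebra_simps sum.distrib)

lemma mult_add_right: "z \<odot> (x + y) = z \<odot> x + z \<odot> y"
  by (intro ext) (simp add: op_mult_def algebra_simps sum.distrib)

lemma mult_diff_left: "(x - y) \<odot> z = x \<odot> z - y \<odot> z"
  by (intro ext) (simp add: op_mult_def algebra_simps sum_subtractf)

lemma mult_diff_right: "z \<odot> (x - y) = z \<odot> x - z \<odot> y"
  by (intro ext) (simp add: op_mult_def algebra_simps sum_subtractf)

lemma mult_scale_left [simp]: "op_scale c x \<odot> y = op_scale c (x \<odot> y)"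
  by (intro ext) (simp add: op_mult_def op_scale_def sum_distrib_left mult.assoc)

lemma mult_scale_right [simp]: "x \<odot> op_scale c y = op_scale c (x \<odot> y)"
  by (intro ext) (simp add: op_mult_def op_scale_def sum_distrib_left mult_ac)

lemma mult_sum_left: "(\<Sum>i\<in>I. f i) \<odot> y = (\<Sum>i\<in>I. f i \<odot> y)"
  unfolding op_mult_def
  by (intro ext) (simp add: sum_fun_apply sum_distrib_right sum.swap[of _ I])

lemma mult_sum_right: "y \<odot> (\<Sum>i\<in>I. f i) = (\<Sum>i\<in>I. y \<odot> f i)"
  unfolding op_mult_def
  by (intro ext) (simp add: sum_fun_apply sum_distrib_left sum.swap[of _ I])

lemma mult_zero_left [simp]: "0 \<odot> y = 0"
  by (intro ext) (simp add: op_mult_def)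

lemma mult_zero_right [simp]: "y \<odot> 0 = 0"
  by (intro ext) (simp add: op_mult_def)

lemma mult_id_left [simp]:
  assumes "x \<in> ops" shows "Id \<odot> x = x"
proof (rule operators_eqI)
  fix s t assume "s \<in> B"
  then have "(Id \<odot> x) s t = (\<Sum>u\<in>B. if u = s then x s t else 0)"
    unfolding op_mult_def by (intro sum.cong) (auto simp: op_id_def)
  then show "(Id \<odot> x) s t = x s t"
    using finite_basis \<open>s \<in> B\<close> by simp
qed (use assms in auto)

lemma mult_id_right [simp]:
  assumes "x \<in> ops" shows "x \<odot> Id = x"
proof (rule operators_eqI)
  fix s t assume "t \<in> B"
  then have "(x \<odot> Id) s t = (\<Sum>u\<in>B. if u = t then x s t else 0)"
    unfolding op_mult_def by (intro sum.cong) (auto simp: op_id_def)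
  then show "(x \<odot> Id) s t = x s t"
    using finite_basis \<open>t \<in> B\<close> by simp
qed (use assms in auto)

lemma adj_mult: "adj (x \<odot> y) = adj y \<odot> adj x"
  by (intro ext) (simp add: adj_def op_mult_def mult.commute)

lemma apply_mult: "op_apply B (x \<odot> y) \<psi> = op_apply B x (op_apply B y \<psi>)"
  unfolding op_apply_def op_mult_def sum_distrib_left sum_distrib_right
  by (intro ext, subst sum.swap) (simp add: mult.assoc)

lemma apply_id:
  assumes "s \<in> B" shows "op_apply B Id \<psi> s = \<psi> s"
proof -
  have "op_apply B Id \<psi> s = (\<Sum>u\<in>B. if u = s then \<psi> s else 0)"
    using assms unfolding op_apply_def by (intro sum.cong) (auto simp: op_id_def)
  then show ?thesis
    using finite_basis assms by simp
qed

lemma apply_sum: "op_apply B (\<Sum>i\<in>I. f i) \<psi> = (\<Sum>i\<in>I. op_apply B (f i) \<psi>)"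
  unfolding op_apply_def
  by (intro ext) (simp add: sum_fun_apply sum_distrib_right sum.swap[of _ I])

lemma op_trace_add: "op_trace B (x + y) = op_trace B x + op_trace B y"
  by (simp add: op_trace_def sum.distrib)

lemma op_trace_zero: "op_trace B 0 = 0"
  by (simp add: op_trace_def)

lemma trace_commute: "op_trace B (x \<odot> y) = op_trace B (y \<odot> x)"
  unfolding op_trace_def op_mult_def
  by (subst sum.swap) (simp add: mult.commute)

subsection \<open>The operator norm\<close>

lemma vec_norm_nonneg [simp]: "0 \<le> vec_norm B \<psi>"
  by (simp add: vec_norm_def)

lemma vec_norm_sq: "complex_of_real ((vec_norm B \<psi>)\<^sup>2) = inner_on B \<psi> \<psi>"
proof -
  have "complex_of_real ((vec_norm B \<psi>)\<^sup>2) = complex_of_real (\<Sum>s\<in>B. (cmod (\<psi> s))\<^sup>2)"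
    by (simp add: vec_norm_def L2_set_def sum_nonneg)
  also have "\<dots> = inner_on B \<psi> \<psi>"
    unfolding inner_on_def of_real_sum
    by (intro sum.cong refl) (simp only: complex_norm_square mult.commute)
  finally show ?thesis .
qed

lemma inner_le: "cmod (inner_on B \<phi> \<psi>) \<le> vec_norm B \<phi> * vec_norm B \<psi>"
proof -
  have "cmod (inner_on B \<phi> \<psi>) \<le> (\<Sum>s\<in>B. \<bar>cmod (\<phi> s)\<bar> * \<bar>cmod (\<psi> s)\<bar>)"
    unfolding inner_on_def by (rule order_trans[OF norm_sum]) (simp add: norm_mult)
  also have "\<dots> \<le> vec_norm B \<phi> * vec_norm B \<psi>"
    unfolding vec_norm_def by (rule L2_set_mult_ineq)
  finally show ?thesis .
qed

lemma inner_sum_right: "inner_on B \<phi> (\<Sum>i\<in>I. f i) = (\<Sum>i\<in>I. inner_on B \<phi> (f i))"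
  unfolding inner_on_def by (simp add: sum_fun_apply sum_distrib_left sum.swap[of _ I])

lemma inner_adj: "inner_on B \<phi> (op_apply B (adj x) \<psi>) = inner_on B (op_apply B x \<phi>) \<psi>"
  unfolding inner_on_def op_apply_def adj_def cnj_sum sum_distrib_left sum_distrib_right
  by (subst sum.swap) (simp add: mult_ac)

lemma vec_norm_add: "vec_norm B (\<lambda>s. \<phi> s + \<psi> s) \<le> vec_norm B \<phi> + vec_norm B \<psi>"
proof -
  have "vec_norm B (\<lambda>s. \<phi> s + \<psi> s) \<le> L2_set (\<lambda>s. cmod (\<phi> s) + cmod (\<psi> s)) B"
    unfolding vec_norm_def by (intro L2_set_mono) (auto simp: norm_triangle_ineq)
  also have "\<dots> \<le> vec_norm B \<phi> + vec_norm B \<psi>"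
    unfolding vec_norm_def by (rule L2_set_triangle_ineq)
  finally show ?thesis .
qed

lemma vec_norm_scale: "vec_norm B (\<lambda>s. c * \<psi> s) = cmod c * vec_norm B \<psi>"
  by (simp add: vec_norm_def norm_mult L2_set_right_distrib)

lemma vec_norm_cong: "(\<And>s. s \<in> B \<Longrightarrow> \<phi> s = \<psi> s) \<Longrightarrow> vec_norm B \<phi> = vec_norm B \<psi>"
  unfolding vec_norm_def by (intro L2_set_cong) auto

text \<open>A crude bound, whose purpose is to make the supremum in \<open>op_norm\<close> bounded,
  so that the rules for conditionally complete suprema apply.\<close>

lemma vec_norm_apply_bounded:
  "vec_norm B (op_apply B x \<psi>) \<le> (\<Sum>s\<in>B. \<Sum>t\<in>B. cmod (x s t)) * vec_norm B \<psi>"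
proof -
  have "vec_norm B (op_apply B x \<psi>) \<le> (\<Sum>s\<in>B. cmod (op_apply B x \<psi> s))"
    unfolding vec_norm_def by (rule L2_set_le_sum) auto
  also have "\<dots> \<le> (\<Sum>s\<in>B. \<Sum>t\<in>B. cmod (x s t) * vec_norm B \<psi>)"
  proof (rule sum_mono)
    fix s
    have "cmod (op_apply B x \<psi> s) \<le> (\<Sum>t\<in>B. cmod (x s t * \<psi> t))"
      unfolding op_apply_def by (rule norm_sum)
    also have "\<dots> \<le> (\<Sum>t\<in>B. cmod (x s t) * vec_norm B \<psi>)"
      unfolding norm_mult vec_norm_def
      using finite_basis by (intro sum_mono mult_left_mono member_le_L2_set) auto
    finally show "cmod (op_apply B x \<psi> s) \<le> (\<Sum>t\<in>B. cmod (x s t) * vec_norm B \<psi>)" .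
  qed
  finally show ?thesis
    by (simp add: sum_distrib_right)
qed

lemma bdd_above_op_norm:
  "bdd_above ((\<lambda>\<psi>. vec_norm B (op_apply B x \<psi>)) ` {\<psi>. vec_norm B \<psi> \<le> 1})"
proof (rule bdd_aboveI2)
  fix \<psi> assume "\<psi> \<in> {\<psi>. vec_norm B \<psi> \<le> 1}"
  then have "(\<Sum>s\<in>B. \<Sum>t\<in>B. cmod (x s t)) * vec_norm B \<psi> \<le> (\<Sum>s\<in>B. \<Sum>t\<in>B. cmod (x s t)) * 1"
    by (intro mult_left_mono) (auto intro!: sum_nonneg)
  with vec_norm_apply_bounded[of x \<psi>]
  show "vec_norm B (op_apply B x \<psi>) \<le> (\<Sum>s\<in>B. \<Sum>t\<in>B. cmod (x s t))"
    by linarith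
qed

lemma op_norm_nonneg [simp]: "0 \<le> nrm x"
proof -
  have "vec_norm B (op_apply B x (\<lambda>_. 0)) \<le> nrm x"
    unfolding op_norm_def
    by (rule cSUP_upper[OF _ bdd_above_op_norm]) (simp add: vec_norm_def L2_set_0')
  then show ?thesis
    using vec_norm_nonneg order_trans by blast
qed

lemma vec_norm_apply_le: "vec_norm B (op_apply B x \<psi>) \<le> nrm x * vec_norm B \<psi>"
\<comment> \<open>A vector of norm 0 cannot be normalised; for it the crude bound already gives
  0.\<close>
proof (cases "vec_norm B \<psi> = 0")
  case True
  then show ?thesis
    using vec_norm_apply_bounded[of x \<psi>] by simp
next
  case False
  define c where "c = vec_norm B \<psi>"
  have c: "c > 0"
    using False unfolding c_def by (simp add: less_le)
  define \<phi> where "\<phi> = (\<lambda>s. complex_of_real (1 / c) * \<psi> s)"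
  have "vec_norm B \<phi> = 1"
    unfolding \<phi>_def vec_norm_scale using c by (simp add: norm_divide flip: c_def)
  then have "vec_norm B (op_apply B x \<phi>) \<le> nrm x"
    unfolding op_norm_def by (intro cSUP_upper[OF _ bdd_above_op_norm]) simp
  moreover have "op_apply B x \<phi> = (\<lambda>s. complex_of_real (1 / c) * op_apply B x \<psi> s)"
    by (intro ext) (simp add: op_apply_def \<phi>_def sum_divide_distrib)
  ultimately have "vec_norm B (op_apply B x \<psi>) / c \<le> nrm x"
    using c vec_norm_scale[of "complex_of_real (1 / c)" "op_apply B x \<psi>"] by (simp add: norm_divide)
  then show ?thesis
    using c unfolding c_def by (simp add: field_simps)
qed

lemma op_norm_leI:
  assumes "\<And>\<psi>. vec_norm B (op_apply B x \<psi>) \<le> c * vec_norm B \<psi>" "0 \<le> c"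
  shows "nrm x \<le> c"
  unfolding op_norm_def
proof (rule cSUP_least)
  show "{\<psi>. vec_norm B \<psi> \<le> 1} \<noteq> {}"
    by (auto intro!: exI[of _ "\<lambda>_. 0"] simp: vec_norm_def L2_set_0')
  fix \<psi> assume "\<psi> \<in> {\<psi>. vec_norm B \<psi> \<le> 1}"
  then have "c * vec_norm B \<psi> \<le> c * 1"
    using assms(2) by (intro mult_left_mono) auto
  with assms(1)[of \<psi>] show "vec_norm B (op_apply B x \<psi>) \<le> c"
    by linarith
qed

lemma op_norm_add: "nrm (x + y) \<le> nrm x + nrm y"
proof (rule op_norm_leI)
  fix \<psi>
  have "op_apply B (x + y) \<psi> = (\<lambda>s. op_apply B x \<psi> s + op_apply B y \<psi> s)"
    by (intro ext) (simp add: op_apply_def algebra_simps sum.distrib)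
  then show "vec_norm B (op_apply B (x + y) \<psi>) \<le> (nrm x + nrm y) * vec_norm B \<psi>"
    using vec_norm_add[of "op_apply B x \<psi>" "op_apply B y \<psi>"]
      vec_norm_apply_le[of x \<psi>] vec_norm_apply_le[of y \<psi>]
    by (simp add: algebra_simps)
qed simp

lemma op_norm_scale_le: "nrm (op_scale c x) \<le> cmod c * nrm x"
proof (rule op_norm_leI)
  fix \<psi>
  have "op_apply B (op_scale c x) \<psi> = (\<lambda>s. c * op_apply B x \<psi> s)"
    by (intro ext) (simp add: op_apply_def op_scale_def algebra_simps sum_distrib_left)
  then show "vec_norm B (op_apply B (op_scale c x) \<psi>) \<le> (cmod c * nrm x) * vec_norm B \<psi>"
    using mult_left_mono[OF vec_norm_apply_le[of x \<psi>], of "cmod c"]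
    by (simp add: vec_norm_scale mult.assoc)
qed simp

lemma op_norm_zero [simp]: "nrm 0 = 0"
proof -
  have "nrm 0 \<le> 0"
    by (rule op_norm_leI) (simp_all add: op_apply_def vec_norm_def L2_set_0')
  then show ?thesis
    using op_norm_nonneg[of 0] by linarith
qed

lemma op_norm_minus_commute: "nrm (x - y) = nrm (y - x)"
proof -
  have "nrm (x - y) \<le> nrm (y - x)" for x y
  proof -
    have "x - y = op_scale (-1) (y - x)"
      by (intro ext) (simp add: op_scale_def)
    then show ?thesis
      using op_norm_scale_le[of "-1" "y - x"] by simp
  qed
  then show ?thesis
    by (simp add: order_antisym)
qed

lemma op_norm_diff: "nrm (x - y) \<le> nrm x + nrm y"
  using op_norm_add[of x "0 - y"] op_norm_minus_commute[of 0 y] by simp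

lemma op_norm_sum: "nrm (\<Sum>i\<in>I. f i) \<le> (\<Sum>i\<in>I. nrm (f i))"
proof (induction I rule: infinite_finite_induct)
  case (insert i I)
  then show ?case
    unfolding sum.insert[OF insert(1,2)] using op_norm_add[of "f i" "sum f I"] by linarith
next
  case empty
  show ?case
    unfolding sum.empty op_norm_zero ..
next
  case (infinite I)
  show ?case
    unfolding sum.infinite[OF infinite] op_norm_zero ..
qed

lemma op_norm_mult: "nrm (x \<odot> y) \<le> nrm x * nrm y"
proof (rule op_norm_leI)
  fix \<psi>
  show "vec_norm B (op_apply B (x \<odot> y) \<psi>) \<le> (nrm x * nrm y) * vec_norm B \<psi>"
    unfolding apply_mult
    using vec_norm_apply_le[of x "op_apply B y \<psi>"]
      mult_left_mono[OF vec_norm_apply_le[of y \<psi>], of "nrm x"]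
    by (simp add: mult.assoc)
qed simp

text \<open>Only an inequality, because the norm of the identity is 0 when \<open>B\<close> is
  empty.\<close>

lemma op_norm_id_le: "nrm Id \<le> 1"
  by (rule op_norm_leI) (simp_all add: vec_norm_cong[of "op_apply B Id _", OF apply_id])

text \<open>Column \<open>t\<close> is the image of a unit basis vector. Hence summability in norm
  yields summability of every entry.\<close>

lemma entry_le_op_norm:
  assumes "s \<in> B" "t \<in> B" shows "cmod (x s t) \<le> nrm x"
proof -
  define e :: "'b \<Rightarrow> complex" where "e = (\<lambda>u. if u = t then 1 else 0)"
  have "vec_norm B e = 1"
    using assms finite_basis
    by (simp add: vec_norm_def L2_set_def e_def if_distrib[of cmod] if_distrib[of "\<lambda>x. x ^ 2"] cong: if_cong)
  moreover have "op_apply B x e = (\<lambda>s. x s t)"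
    using assms finite_basis by (intro ext) (simp add: op_apply_def e_def if_distrib cong: if_cong)
  moreover have "cmod (x s t) \<le> vec_norm B (\<lambda>s. x s t)"
    unfolding vec_norm_def using assms finite_basis by (intro member_le_L2_set) auto
  ultimately show ?thesis
    using vec_norm_apply_le[of x e] by simp
qed

text \<open>The norm of an image vector is a continuous function of finitely many entries. This
  turns bounds on partial sums into bounds on entrywise series.\<close>

lemma op_norm_limit:
  assumes X: "\<And>s t. s \<in> B \<Longrightarrow> t \<in> B \<Longrightarrow> (\<lambda>n. X n s t) \<longlonglongrightarrow> x s t"
    and le: "\<And>n. nrm (X n) \<le> c"
  shows "nrm x \<le> c"
proof (rule op_norm_leI)
  show "0 \<le> c"
    using op_norm_nonneg le order_trans by blast
  fix \<psi>
  have "(\<lambda>n. vec_norm B (op_apply B (X n) \<psi>)) \<longlonglongrightarrow> vec_norm B (op_apply B x \<psi>)"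
    unfolding vec_norm_def L2_set_def op_apply_def
    by (intro tendsto_real_sqrt tendsto_sum tendsto_power tendsto_norm tendsto_mult X tendsto_const)
  moreover have "vec_norm B (op_apply B (X n) \<psi>) \<le> c * vec_norm B \<psi>" for n
    using vec_norm_apply_le[of "X n" \<psi>] mult_right_mono[OF le[of n], of "vec_norm B \<psi>"] by simp
  ultimately show "vec_norm B (op_apply B x \<psi>) \<le> c * vec_norm B \<psi>"
    by (intro LIMSEQ_le_const2) auto
qed

text \<open>Cauchy--Schwarz for the vectors \<open>K\<^sub>i \<phi>\<close> and \<open>K\<^sub>i \<psi>\<close>, tested with \<open>\<phi> = (\<Sum> K\<^sub>i\<^sup>* x K\<^sub>i) \<psi>\<close>.\<close>

lemma op_norm_kraus_le:
  assumes "(\<Sum>i\<in>I. adj (K i) \<odot> K i) = Id"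
  shows "nrm (\<Sum>i\<in>I. adj (K i) \<odot> x \<odot> K i) \<le> nrm x"
proof (rule op_norm_leI)
  fix \<psi>
  \<comment> \<open>The normalisation of the \<open>K i\<close> makes the map from \<xi> to the
    family of its images under the \<open>K i\<close> an isometry.\<close>
  have K: "L2_set (\<lambda>i. vec_norm B (op_apply B (K i) \<xi>)) I = vec_norm B \<xi>" for \<xi>
  proof -
    have "complex_of_real (\<Sum>i\<in>I. (vec_norm B (op_apply B (K i) \<xi>))\<^sup>2) =
        inner_on B \<xi> (op_apply B (\<Sum>i\<in>I. adj (K i) \<odot> K i) \<xi>)"
      by (simp add: vec_norm_sq[simplified] apply_sum inner_sum_right apply_mult inner_adj)
    also have "\<dots> = inner_on B \<xi> \<xi>"
      unfolding assms inner_on_def by (intro sum.cong) (auto simp: apply_id)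
    also have "\<dots> = complex_of_real ((vec_norm B \<xi>)\<^sup>2)"
      by (simp only: vec_norm_sq)
    finally have "(\<Sum>i\<in>I. (vec_norm B (op_apply B (K i) \<xi>))\<^sup>2) = (vec_norm B \<xi>)\<^sup>2"
      by (simp only: of_real_eq_iff)
    then show ?thesis
      by (simp add: L2_set_def)
  qed
  define \<phi> where "\<phi> = op_apply B (\<Sum>i\<in>I. adj (K i) \<odot> x \<odot> K i) \<psi>"
  have "inner_on B \<phi> \<phi> =
      (\<Sum>i\<in>I. inner_on B (op_apply B (K i) \<phi>) (op_apply B x (op_apply B (K i) \<psi>)))"
    unfolding apply_sum inner_sum_right[symmetric] inner_adj[symmetric] \<phi>_def
    by (simp add: apply_mult mult_assoc inner_adj)
  then have "(vec_norm B \<phi>)\<^sup>2 =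
      cmod (\<Sum>i\<in>I. inner_on B (op_apply B (K i) \<phi>) (op_apply B x (op_apply B (K i) \<psi>)))"
    unfolding vec_norm_sq[symmetric] by (metis abs_power2 norm_of_real)
  also have "\<dots> \<le> (\<Sum>i\<in>I. vec_norm B (op_apply B (K i) \<phi>) * (nrm x * vec_norm B (op_apply B (K i) \<psi>)))"
    by (intro order_trans[OF norm_sum] sum_mono order_trans[OF inner_le] mult_left_mono
        vec_norm_apply_le vec_norm_nonneg)
  also have "\<dots> = nrm x *
      (\<Sum>i\<in>I. \<bar>vec_norm B (op_apply B (K i) \<phi>)\<bar> * \<bar>vec_norm B (op_apply B (K i) \<psi>)\<bar>)"
    by (simp add: sum_distrib_left mult_ac)
  also have "\<dots> \<le> nrm x * (vec_norm B \<phi> * vec_norm B \<psi>)"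
    using L2_set_mult_ineq[of "\<lambda>i. vec_norm B (op_apply B (K i) \<phi>)"
        "\<lambda>i. vec_norm B (op_apply B (K i) \<psi>)" I]
    by (intro mult_left_mono) (simp_all add: K)
  finally have "vec_norm B \<phi> * vec_norm B \<phi> \<le> vec_norm B \<phi> * (nrm x * vec_norm B \<psi>)"
    by (simp add: power2_eq_square mult_ac)
  \<comment> \<open>One factor \<open>vec_norm B \<phi>\<close> cancels unless it is 0, and in that
    case the bound is immediate.\<close>
  then show "vec_norm B (op_apply B (\<Sum>i\<in>I. adj (K i) \<odot> x \<odot> K i) \<psi>) \<le> nrm x * vec_norm B \<psi>"
    unfolding \<phi>_def[symmetric] using vec_norm_nonneg[of \<phi>]
    by (cases "vec_norm B \<phi> = 0") (auto simp: less_le)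
qed simp

subsection \<open>Square roots and inverses\<close>

text \<open>The squared Hilbert-Schmidt norm. It detects the zero operator, and it makes the
  partition function positive later on.\<close>

lemma trace_adj_mult: "op_trace B (adj x \<odot> x) = complex_of_real (\<Sum>s\<in>B. \<Sum>u\<in>B. (cmod (x u s))\<^sup>2)"
  unfolding op_trace_def op_mult_def adj_def of_real_sum
  by (intro sum.cong refl) (simp add: complex_norm_square mult.commute del: of_real_power)

lemma trace_adj_mult_eq_0:
  assumes "x \<in> ops" "op_trace B (adj x \<odot> x) = 0"
  shows "x = 0"
proof -
  have "(\<Sum>s\<in>B. \<Sum>u\<in>B. (cmod (x u s))\<^sup>2) = 0"
    using assms(2) unfolding trace_adj_mult by (simp only: of_real_eq_0_iff)
  then have "\<forall>s\<in>B. \<forall>u\<in>B. x u s = 0"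
    using finite_basis by (simp add: sum_nonneg_eq_0_iff sum_nonneg)
  then show ?thesis
    using assms(1) by (intro operators_eqI[of _ B]) auto
qed

lemma positive_semidef_square:
  assumes "adj w = w" shows "positive_semidef B (w \<odot> w)"
proof -
  have "(\<Sum>s\<in>B. cnj (\<psi> s) * op_apply B (w \<odot> w) \<psi> s) =
      complex_of_real ((vec_norm B (op_apply B w \<psi>))\<^sup>2)" for \<psi>
    unfolding vec_norm_sq inner_adj[symmetric] assms
    by (simp add: inner_on_def apply_mult)
  then show ?thesis
    using assms by (simp add: positive_semidef_def self_adjoint_iff_adj adj_mult)
qed

text \<open>If \<open>y\<^sup>2 = z\<^sup>2\<close> with \<open>z = w\<^sup>2\<close>, then \<open>D = y - z\<close> satisfies \<open>y D + D z = 0\<close>.  Multiplying by \<open>D\<close> and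
  taking the trace gives \<open>Tr (D y D) + Tr ((w D)\<^sup>* w D) = 0\<close>, where both terms are nonnegative.
  This proves uniqueness without the spectral theorem.\<close>

lemma op_sqrt_eq:
  assumes w: "w \<in> ops" "adj w = w" and w': "w' \<odot> w = Id" "w' \<in> ops" and z: "z = w \<odot> w"
  shows "op_sqrt B (z \<odot> z) = z"
  unfolding op_sqrt_def
proof (rule the_equality)
  have zops: "z \<in> ops" and zadj: "adj z = z"
    using w by (auto simp: z adj_mult)
  show "z \<in> ops \<and> positive_semidef B z \<and> z \<odot> z = z \<odot> z"
    using zops positive_semidef_square[OF w(2)] by (simp add: z)
  fix y assume y: "y \<in> ops \<and> positive_semidef B y \<and> y \<odot> y = z \<odot> z"
  define D where "D = y - z"
  have Dops: "D \<in> ops" and Dadj: "adj D = D"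
    using y zops zadj by (auto simp: D_def adj_diff positive_semidef_def self_adjoint_iff_adj)
  have "y \<odot> D + D \<odot> z = 0"
    using y by (simp add: D_def mult_diff_left mult_diff_right)
  then have "D \<odot> y \<odot> D + D \<odot> D \<odot> z = 0"
    by (metis mult_add_right mult_assoc mult_zero_right)
  then have "op_trace B (D \<odot> y \<odot> D) + op_trace B (D \<odot> D \<odot> z) = 0"
    by (metis op_trace_add op_trace_zero)
  moreover have "op_trace B (D \<odot> D \<odot> z) = op_trace B (adj (w \<odot> D) \<odot> (w \<odot> D))"
    unfolding adj_mult w(2) Dadj by (subst trace_commute[of "D \<odot> w"], unfold mult_assoc[of D D])
      (subst trace_commute, simp add: z mult_assoc, metis mult_assoc trace_commute)
  ultimately have "Re (op_trace B (D \<odot> y \<odot> D)) + (\<Sum>s\<in>B. \<Sum>u\<in>B. (cmod ((w \<odot> D) u s))\<^sup>2) = 0"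
    unfolding trace_adj_mult by (metis Re_complex_of_real plus_complex.simps(1) zero_complex.simps(1))
  moreover have "0 \<le> Re (op_trace B (D \<odot> y \<odot> D))"
  proof -
    have "op_trace B (D \<odot> y \<odot> D) = op_trace B (adj D \<odot> (y \<odot> D))"
      by (simp add: Dadj mult_assoc)
    \<comment> \<open>The trace is the sum of the quadratic forms of \<open>y\<close> at the columns
      of \<open>D\<close>.\<close>
    also have "\<dots> = (\<Sum>t\<in>B. \<Sum>s\<in>B. cnj (D s t) * op_apply B y (\<lambda>u. D u t) s)"
      by (simp add: op_trace_def op_mult_def op_apply_def adj_def)
    finally show ?thesis
      using y unfolding positive_semidef_def by (simp del: Re_sum add: Re_sum[of _ B] sum_nonneg)
  qed
  moreover have "0 \<le> (\<Sum>s\<in>B. \<Sum>u\<in>B. (cmod ((w \<odot> D) u s))\<^sup>2)"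
    by (intro sum_nonneg) auto
  ultimately have "op_trace B (adj (w \<odot> D) \<odot> (w \<odot> D)) = 0"
    unfolding trace_adj_mult by (smt (verit) of_real_0)
  then have "w \<odot> D = 0"
    using trace_adj_mult_eq_0 w Dops by simp
  \<comment> \<open>Invertibility of \<open>w\<close> stands in for strict positivity of
    \<open>z\<close>.\<close>
  then have "w' \<odot> w \<odot> D = 0"
    by (simp add: mult_assoc)
  then show "y = z"
    using w' Dops by (simp add: D_def)
qed

lemma op_inverse_eq:
  assumes "y \<in> ops" "x \<odot> y = Id" "y \<odot> x = Id"
  shows "op_inverse B x = y"
  unfolding op_inverse_def
proof (rule the_equality)
  fix y' assume y': "y' \<in> ops \<and> x \<odot> y' = Id \<and> y' \<odot> x = Id"
  then have "y' = y' \<odot> (x \<odot> y)"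
    using assms by simp
  also have "\<dots> = y"
    using y' assms mult_assoc[of y' x y] by simp
  finally show "y' = y" .
qed (use assms in auto)

subsection \<open>Absolutely convergent series\<close>

text \<open>Membership in \<open>ops\<close> is part of the notion: entries outside the basis then
  vanish, so the entrywise series converges at all arguments.\<close>

definition abs_summable :: "(nat \<Rightarrow> 'b opr) \<Rightarrow> bool" where
  "abs_summable X \<longleftrightarrow> (\<forall>n. X n \<in> ops) \<and> summable (\<lambda>n. nrm (X n))"

definition opsum :: "(nat \<Rightarrow> 'b opr) \<Rightarrow> 'b opr" where
  "opsum X = (\<lambda>s t. \<Sum>n. X n s t)"

lemma abs_summableI:
  assumes "\<And>n. X n \<in> ops" "\<And>n. nrm (X n) \<le> a n" "summable a"
  shows "abs_summable X"
  unfolding abs_summable_def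
proof
  show "summable (\<lambda>n. nrm (X n))"
    by (rule summable_comparison_test'[of a 0]) (use assms in auto)
qed (use assms in auto)

lemma abs_summable_entries:
  assumes "abs_summable X" shows "summable (\<lambda>n. cmod (X n s t))"
proof (cases "s \<in> B \<and> t \<in> B")
  case True
  then show ?thesis
    using assms by (auto simp: abs_summable_def intro!: entry_le_op_norm summable_comparison_test'[of "\<lambda>n. nrm (X n)" 0])
next
  case False
  then have "X n s t = 0" for n
    using assms operators_outside[of "X n" B s t for n] by (auto simp: abs_summable_def)
  then show ?thesis
    by simp
qed

lemma opsum_sums: "abs_summable X \<Longrightarrow> (\<lambda>n. X n s t) sums opsum X s t"
  unfolding opsum_def by (rule summable_sums, rule summable_norm_cancel, rule abs_summable_entries)

lemma opsum_eqI:
  assumes "\<And>s t. (\<lambda>n. X n s t) sums y s t" shows "opsum X = y"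
  unfolding opsum_def using assms by (intro ext) (simp add: sums_unique[symmetric])

lemma opsum_in_ops [simp]: "abs_summable X \<Longrightarrow> opsum X \<in> ops"
  unfolding operators_def
proof (intro CollectI allI impI)
  fix s t assume X: "abs_summable X" and nz: "opsum X s t \<noteq> 0"
  show "s \<in> B \<and> t \<in> B"
  proof (rule ccontr)
    assume "\<not> (s \<in> B \<and> t \<in> B)"
    then have "X n s t = 0" for n
      using X operators_outside[of "X n" B s t for n] by (auto simp: abs_summable_def)
    with nz show False
      by (simp add: opsum_def)
  qed
qed

text \<open>The majorant \<open>a\<close> is kept separate from the norms so that the bound can be
  the explicit value of a numerical series.\<close>

lemma op_norm_opsum:
  assumes "abs_summable X" "\<And>n. nrm (X n) \<le> a n" "summable a"
  shows "nrm (opsum X) \<le> suminf a"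
proof (rule op_norm_limit)
  show "(\<lambda>n. (\<Sum>k<n. X k) s t) \<longlonglongrightarrow> opsum X s t" for s t
    using opsum_sums[OF assms(1)] by (simp add: sums_def sum_fun_apply)
  show "nrm (\<Sum>k<n. X k) \<le> suminf a" for n
  proof -
    have "nrm (\<Sum>k<n. X k) \<le> (\<Sum>k<n. a k)"
      by (rule order_trans[OF op_norm_sum]) (intro sum_mono assms)
    also have "\<dots> \<le> suminf a"
      using assms order_trans[OF op_norm_nonneg] by (intro sum_le_suminf) auto
    finally show ?thesis .
  qed
qed

lemma mult_opsum_right: "abs_summable X \<Longrightarrow> y \<odot> opsum X = opsum (\<lambda>n. y \<odot> X n)"
  by (rule opsum_eqI[symmetric]) (auto simp: op_mult_def intro!: sums_sum sums_mult opsum_sums)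

lemma mult_opsum_left: "abs_summable X \<Longrightarrow> opsum X \<odot> y = opsum (\<lambda>n. X n \<odot> y)"
  by (rule opsum_eqI[symmetric]) (auto simp: op_mult_def intro!: sums_sum sums_mult2 opsum_sums)

lemma opsum_commute:
  assumes "abs_summable X" "\<And>n. y \<odot> X n = X n \<odot> y"
  shows "y \<odot> opsum X = opsum X \<odot> y"
  using assms by (simp add: mult_opsum_left mult_opsum_right)

lemma adj_opsum:
  assumes "abs_summable X" shows "adj (opsum X) = opsum (\<lambda>n. adj (X n))"
  by (rule opsum_eqI[symmetric]) (simp add: adj_def sums_cnj opsum_sums assms)

text \<open>A Cauchy product for each pair of entries, interchanged with the finite sum over
  intermediate basis labels.\<close>

lemma opsum_mult:
  assumes X: "abs_summable X" and Y: "abs_summable Y"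
  shows "opsum X \<odot> opsum Y = opsum (\<lambda>n. \<Sum>k\<le>n. X k \<odot> Y (n - k))"
proof (rule opsum_eqI[symmetric])
  fix s t
  have "(\<lambda>n. \<Sum>u\<in>B. \<Sum>k\<le>n. X k s u * Y (n - k) u t) sums (\<Sum>u\<in>B. opsum X s u * opsum Y u t)"
    unfolding opsum_def using X Y
    by (intro sums_sum Cauchy_product_sums abs_summable_entries) auto
  then show "(\<lambda>n. (\<Sum>k\<le>n. X k \<odot> Y (n - k)) s t) sums (opsum X \<odot> opsum Y) s t"
    unfolding op_mult_def sum_fun_apply by (subst sum.swap) simp
qed

subsection \<open>Power series\<close>

abbreviation pow :: "'b opr \<Rightarrow> nat \<Rightarrow> 'b opr" where
  "pow x n \<equiv> (op_mult B x ^^ n) Id"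

lemma pow_in_ops [simp]: "x \<in> ops \<Longrightarrow> pow x n \<in> ops"
  by (induction n) auto

lemma pow_commute:
  assumes "x \<in> ops" "y \<in> ops" "y \<odot> x = x \<odot> y" shows "y \<odot> pow x n = pow x n \<odot> y"
proof (induction n)
  case (Suc n)
  have "y \<odot> pow x (Suc n) = x \<odot> (y \<odot> pow x n)"
    using assms by (simp flip: mult_assoc)
  then show ?case
    by (simp add: Suc mult_assoc)
qed (use assms in auto)

lemma pow_add: "x \<in> ops \<Longrightarrow> pow x j \<odot> pow x k = pow x (j + k)"
  by (induction j) (auto simp: mult_assoc)

lemma op_norm_pow: "x \<in> ops \<Longrightarrow> nrm (pow x n) \<le> nrm x ^ n"
proof (induction n)
  case (Suc n)
  then show ?case
    using op_norm_mult[of x "pow x n"] mult_left_mono[of "nrm (pow x n)" "nrm x ^ n" "nrm x"] by simp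
qed (simp add: op_norm_id_le)

lemma adj_pow: "x \<in> ops \<Longrightarrow> adj x = x \<Longrightarrow> adj (pow x n) = pow x n"
  by (induction n) (simp_all add: adj_mult pow_commute)

definition opser :: "(nat \<Rightarrow> real) \<Rightarrow> 'b opr \<Rightarrow> 'b opr" where
  "opser c x = opsum (\<lambda>n. op_scale (complex_of_real (c n)) (pow x n))"

lemma op_norm_opser_term:
  assumes "x \<in> ops" "nrm x \<le> r"
  shows "nrm (op_scale (complex_of_real (c n)) (pow x n)) \<le> \<bar>c n\<bar> * r ^ n"
proof -
  have "nrm (op_scale (complex_of_real (c n)) (pow x n)) \<le> \<bar>c n\<bar> * nrm (pow x n)"
    using op_norm_scale_le[of "complex_of_real (c n)" "pow x n"] by simp
  also have "\<dots> \<le> \<bar>c n\<bar> * r ^ n"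
    using assms
    by (intro mult_left_mono order_trans[OF op_norm_pow] power_mono) auto
  finally show ?thesis .
qed

definition ser_conv :: "(nat \<Rightarrow> real) \<Rightarrow> 'b opr \<Rightarrow> bool" where
  "ser_conv c x \<longleftrightarrow> x \<in> ops \<and> summable (\<lambda>n. \<bar>c n\<bar> * nrm x ^ n)"

lemma abs_summable_opser:
  assumes "ser_conv c x"
  shows "abs_summable (\<lambda>n. op_scale (complex_of_real (c n)) (pow x n))"
  using assms unfolding ser_conv_def
  by (intro abs_summableI[OF _ op_norm_opser_term[OF _ order.refl]]) auto

lemma opser_in_ops [simp]: "ser_conv c x \<Longrightarrow> opser c x \<in> ops"
  unfolding opser_def by (intro opsum_in_ops abs_summable_opser)

lemma opser_commute:
  assumes "ser_conv c x" "y \<in> ops" "y \<odot> x = x \<odot> y"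
  shows "y \<odot> opser c x = opser c x \<odot> y"
  unfolding opser_def using assms pow_commute[of x y]
  by (intro opsum_commute abs_summable_opser) (auto simp: ser_conv_def)

lemma adj_opser:
  assumes "ser_conv c x" "adj x = x" shows "adj (opser c x) = opser c x"
  unfolding opser_def
  using assms by (simp add: adj_opsum abs_summable_opser adj_scale adj_pow ser_conv_def)

lemma opser_mult:
  assumes "ser_conv c x" "ser_conv e x"
  shows "opser c x \<odot> opser e x = opser (\<lambda>n. \<Sum>k\<le>n. c k * e (n - k)) x"
proof -
  have x: "x \<in> ops"
    using assms by (simp add: ser_conv_def)
  have "(\<Sum>k\<le>n. op_scale (complex_of_real (c k)) (pow x k) \<odot>
      op_scale (complex_of_real (e (n - k))) (pow x (n - k))) =
      op_scale (complex_of_real (\<Sum>k\<le>n. c k * e (n - k))) (pow x n)" for n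
  proof -
    have "(\<Sum>k\<le>n. op_scale (complex_of_real (c k)) (pow x k) \<odot>
      op_scale (complex_of_real (e (n - k))) (pow x (n - k))) =
      (\<Sum>k\<le>n. op_scale (complex_of_real (c k * e (n - k))) (pow x n))"
      by (intro sum.cong refl) (simp add: pow_add x mult_ac)
    also have "\<dots> = op_scale (complex_of_real (\<Sum>k\<le>n. c k * e (n - k))) (pow x n)"
      by (intro ext) (simp add: op_scale_def sum_fun_apply sum_distrib_right)
    finally show ?thesis .
  qed
  then show ?thesis
    unfolding opser_def by (simp add: opsum_mult abs_summable_opser assms)
qed

lemma opser_split_head:
  assumes "ser_conv c x"
  shows "opser c x = op_scale (complex_of_real (c 0)) Id + opser (c(0 := 0)) x"
proof -
  have "opser (c(0 := 0)) x = opser c x - op_scale (complex_of_real (c 0)) Id"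
    unfolding opser_def[of "c(0 := 0)"]
  proof (rule opsum_eqI)
    fix s t
    have "(\<lambda>n. op_scale (complex_of_real (c n)) (pow x n) s t -
        (if n = 0 then op_scale (complex_of_real (c 0)) Id s t else 0))
        sums (opser c x s t - op_scale (complex_of_real (c 0)) Id s t)"
      unfolding opser_def
      by (intro sums_diff opsum_sums abs_summable_opser[OF assms] sums_single)
    moreover have "op_scale (complex_of_real (c n)) (pow x n) s t -
        (if n = 0 then op_scale (complex_of_real (c 0)) Id s t else 0) =
        op_scale (complex_of_real ((c(0 := 0)) n)) (pow x n) s t" for n
      by (simp add: op_scale_def)
    ultimately show "(\<lambda>n. op_scale (complex_of_real ((c(0 := 0)) n)) (pow x n) s t)
        sums (opser c x - op_scale (complex_of_real (c 0)) Id) s t"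
      by simp
  qed
  then show ?thesis
    by simp
qed

text \<open>Comparison with the scalar series of absolute values at a radius \<open>r\<close>,
  without its constant term. The exponential and the binomial series both get their distance to the
  identity from here.\<close>

lemma op_norm_opser_minus_head:
  assumes "x \<in> ops" "nrm x \<le> r" "summable (\<lambda>n. \<bar>c n\<bar> * r ^ n)"
  shows "nrm (opser c x - op_scale (complex_of_real (c 0)) Id) \<le> (\<Sum>n. \<bar>c n\<bar> * r ^ n) - \<bar>c 0\<bar>"
proof -
  have r: "0 \<le> r"
    using assms(2) op_norm_nonneg order_trans by blast
  have sc: "ser_conv c x"
    unfolding ser_conv_def
  proof
    show "summable (\<lambda>n. \<bar>c n\<bar> * nrm x ^ n)"
      by (rule summable_comparison_test'[OF assms(3), of 0])
        (use assms in \<open>auto intro!: mult_left_mono power_mono\<close>)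
  qed (rule assms(1))
  have sums: "(\<lambda>n. \<bar>(c(0 := 0)) n\<bar> * r ^ n) sums ((\<Sum>n. \<bar>c n\<bar> * r ^ n) - \<bar>c 0\<bar>)"
  proof -
    have "(\<lambda>n. \<bar>c n\<bar> * r ^ n - (if n = 0 then \<bar>c 0\<bar> else 0)) sums ((\<Sum>n. \<bar>c n\<bar> * r ^ n) - \<bar>c 0\<bar>)"
      by (intro sums_diff summable_sums assms sums_single)
    moreover have "\<bar>c n\<bar> * r ^ n - (if n = 0 then \<bar>c 0\<bar> else 0) = \<bar>(c(0 := 0)) n\<bar> * r ^ n" for n
      by simp
    ultimately show ?thesis
      by simp
  qed
  have "nrm (opser (c(0 := 0)) x) \<le> (\<Sum>n. \<bar>(c(0 := 0)) n\<bar> * r ^ n)"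
    unfolding opser_def
    using assms sums_summable[OF sums]
    by (intro op_norm_opsum abs_summableI[OF _ op_norm_opser_term] op_norm_opser_term) auto
  then show ?thesis
    using opser_split_head[OF sc] sums_unique[OF sums] by simp
qed

subsection \<open>The exponential\<close>

lemma op_exp_eq_opser: "op_exp B x = opser (\<lambda>n. 1 / fact n) x"
  by (intro ext) (simp add: op_exp_def opser_def opsum_def op_scale_def)

lemma exp_coeff_sums: "(\<lambda>n. \<bar>1 / fact n\<bar> * r ^ n) sums exp (r :: real)"
  using exp_converges[of r] by (simp add: field_simps)

lemma ser_conv_exp: "x \<in> ops \<Longrightarrow> ser_conv (\<lambda>n. 1 / fact n) x"
  unfolding ser_conv_def using exp_coeff_sums sums_summable by blast

lemma op_exp_in_ops [simp]: "x \<in> ops \<Longrightarrow> op_exp B x \<in> ops"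
  by (simp add: op_exp_eq_opser ser_conv_exp)

lemma op_exp_commute: "x \<in> ops \<Longrightarrow> y \<in> ops \<Longrightarrow> y \<odot> x = x \<odot> y \<Longrightarrow> y \<odot> op_exp B x = op_exp B x \<odot> y"
  by (simp add: op_exp_eq_opser ser_conv_exp opser_commute)

lemma adj_op_exp: "x \<in> ops \<Longrightarrow> adj x = x \<Longrightarrow> adj (op_exp B x) = op_exp B x"
  by (simp add: op_exp_eq_opser ser_conv_exp adj_opser)

lemma op_norm_op_exp_minus_id:
  assumes "x \<in> ops" "nrm x \<le> r"
  shows "nrm (op_exp B x - Id) \<le> exp r - 1"
  using op_norm_opser_minus_head[OF assms, of "\<lambda>n. 1 / fact n"] sums_unique[OF exp_coeff_sums[of r]]
    sums_summable[OF exp_coeff_sums[of r]]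
  by (simp add: op_exp_eq_opser)

lemma op_exp_zero [simp]: "op_exp B 0 = Id"
  unfolding op_exp_eq_opser opser_def
proof (rule opsum_eqI)
  fix s t
  have "op_scale (complex_of_real (1 / fact n)) (pow 0 n) s t = (if n = 0 then Id s t else 0)" for n
    by (cases n) (auto simp: op_scale_def)
  then show "(\<lambda>n. op_scale (complex_of_real (1 / fact n)) (pow 0 n) s t) sums Id s t"
    using sums_single[of 0 "\<lambda>_. Id s t"] by simp
qed

lemma pow_add_commuting:
  assumes "x \<in> ops" "y \<in> ops" "x \<odot> y = y \<odot> x"
  shows "pow (x + y) n s t = (\<Sum>i\<le>n. of_nat (n choose i) * (pow x i \<odot> pow y (n - i)) s t)"
proof -
  \<comment> \<open>An entry of x^k y^j (x + y)^n; moving one factor x + y into the powers raises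
    either k or j.\<close>
  define W where "W = (\<lambda>n k j. (pow x k \<odot> pow y j \<odot> pow (x + y) n) s t)"
  have "pow x k \<odot> pow y j \<odot> pow (x + y) (Suc n) =
      pow x (Suc k) \<odot> pow y j \<odot> pow (x + y) n + pow x k \<odot> pow y (Suc j) \<odot> pow (x + y) n" for n k j
  proof -
    have "pow x k \<odot> pow y j \<odot> (x + y) = pow x k \<odot> (pow y j \<odot> x) + pow x k \<odot> (pow y j \<odot> y)"
      by (simp add: mult_assoc mult_add_right)
    also have "\<dots> = (pow x k \<odot> x) \<odot> pow y j + pow x k \<odot> (y \<odot> pow y j)"
      using assms pow_commute[of y x j] pow_commute[of y y j] by (simp add: mult_assoc)
    also have "\<dots> = pow x (Suc k) \<odot> pow y j + pow x k \<odot> pow y (Suc j)"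
      using assms pow_commute[of x x k] by simp
    finally have "pow x k \<odot> pow y j \<odot> (x + y) = pow x (Suc k) \<odot> pow y j + pow x k \<odot> pow y (Suc j)" .
    from arg_cong[OF this, of "\<lambda>z. z \<odot> pow (x + y) n"] show ?thesis
      by (simp only: funpow.simps o_apply mult_add_left mult_assoc)
  qed
  then have "W (Suc n) k j = W n (Suc k) j + W n k (Suc j)" for n k j
    unfolding W_def by (simp only: plus_fun_apply)
  from binomial_expansion_of_recurrence[of W, OF this, of n 0 0] show ?thesis
    using assms by (simp add: W_def)
qed

text \<open>The Cauchy product of the two series is compared coefficientwise with the binomial
  expansion for commuting operators.\<close>

lemma op_exp_add:
  assumes "x \<in> ops" "y \<in> ops" "x \<odot> y = y \<odot> x"
  shows "op_exp B (x + y) = op_exp B x \<odot> op_exp B y"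
proof -
  have "(\<Sum>k\<le>n. op_scale (complex_of_real (1 / fact k)) (pow x k) \<odot>
      op_scale (complex_of_real (1 / fact (n - k))) (pow y (n - k))) =
      op_scale (complex_of_real (1 / fact n)) (pow (x + y) n)" for n
  proof (intro ext)
    fix s t
    have coeff: "complex_of_real (1 / fact k) * complex_of_real (1 / fact (n - k)) =
        complex_of_real (1 / fact n) * of_nat (n choose k)" if "k \<le> n" for k
      using binomial_fact[OF that, where 'a = complex] by simp
    then show "(\<Sum>k\<le>n. op_scale (complex_of_real (1 / fact k)) (pow x k) \<odot>
      op_scale (complex_of_real (1 / fact (n - k))) (pow y (n - k))) s t =
      op_scale (complex_of_real (1 / fact n)) (pow (x + y) n) s t"
      unfolding sum_fun_apply mult_scale_left mult_scale_right op_scale_scale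
      unfolding op_scale_def pow_add_commuting[OF assms] sum_distrib_left
    proof (intro sum.cong refl)
      fix k assume "k \<in> {..n}"
      then show "complex_of_real (1 / fact (n - k)) * complex_of_real (1 / fact k) *
          (pow x k \<odot> pow y (n - k)) s t =
          complex_of_real (1 / fact n) * (of_nat (n choose k) * (pow x k \<odot> pow y (n - k)) s t)"
        using coeff[of k] by (simp only: mult.assoc[symmetric] atMost_iff mult.commute[of _ "complex_of_real (1 / fact k)"])
    qed
  qed
  then show ?thesis
    unfolding op_exp_eq_opser opser_def
    using opsum_mult[OF abs_summable_opser[OF ser_conv_exp] abs_summable_opser[OF ser_conv_exp]] assms(1,2)
    by (simp only:)
qed

definition expo :: "real \<Rightarrow> 'b opr \<Rightarrow> 'b opr" where
  "expo \<theta> x = op_exp B (op_scale (complex_of_real \<theta>) x)"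

lemma expo_in_ops [simp]: "x \<in> ops \<Longrightarrow> expo \<theta> x \<in> ops"
  by (simp add: expo_def)

lemma expo_0 [simp]: "expo 0 x = Id"
proof -
  have "op_scale (complex_of_real 0) x = 0"
    by (intro ext) (simp add: op_scale_def)
  then show ?thesis
    by (simp add: expo_def)
qed

lemma expo_mult: "x \<in> ops \<Longrightarrow> expo \<theta> x \<odot> expo \<phi> x = expo (\<theta> + \<phi>) x"
proof -
  assume x: "x \<in> ops"
  have "op_scale (complex_of_real (\<theta> + \<phi>)) x =
      op_scale (complex_of_real \<theta>) x + op_scale (complex_of_real \<phi>) x"
    by (intro ext) (simp add: op_scale_def algebra_simps)
  then show ?thesis
    using x by (simp add: expo_def op_exp_add mult.commute)
qed

lemma expo_add:
  "x \<in> ops \<Longrightarrow> y \<in> ops \<Longrightarrow> x \<odot> y = y \<odot> x \<Longrightarrow> expo \<theta> (x + y) = expo \<theta> x \<odot> expo \<theta> y"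
  by (simp add: expo_def op_scale_add op_exp_add)

lemma adj_expo: "x \<in> ops \<Longrightarrow> adj x = x \<Longrightarrow> adj (expo \<theta> x) = expo \<theta> x"
  by (simp add: expo_def adj_op_exp adj_scale)

lemma expo_commute:
  "x \<in> ops \<Longrightarrow> y \<in> ops \<Longrightarrow> y \<odot> x = x \<odot> y \<Longrightarrow> y \<odot> expo \<theta> x = expo \<theta> x \<odot> y"
  by (simp add: expo_def op_exp_commute)

lemma op_norm_expo_minus_id:
  assumes "x \<in> ops" "\<bar>\<theta>\<bar> * nrm x \<le> r"
  shows "nrm (expo \<theta> x - Id) \<le> exp r - 1"
  unfolding expo_def using assms op_norm_scale_le[of "complex_of_real \<theta>" x]
  by (intro op_norm_op_exp_minus_id) auto

text \<open>With \<open>D = K - Id\<close> the difference is D y + y D + D y D, and 2 k + k^2 = (1 +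
  k)^2 - 1. The lemma is meant for factors near the identity: the Boltzmann factor and the
  normalising power around it.\<close>

lemma op_norm_sandwich_diff:
  assumes "K \<in> ops" "y \<in> ops" "nrm (K - Id) \<le> k"
  shows "nrm (K \<odot> y \<odot> K - y) \<le> ((1 + k)\<^sup>2 - 1) * nrm y"
    and "nrm (K \<odot> y \<odot> K) \<le> (1 + k)\<^sup>2 * nrm y"
proof -
  define D where "D = K - Id"
  have D: "D \<in> ops" "nrm D \<le> k"
    using assms by (simp_all add: D_def)
  then have k: "0 \<le> k"
    using op_norm_nonneg order_trans by blast
  have K: "K = D + Id"
    by (simp add: D_def)
  have "K \<odot> y \<odot> K - y = D \<odot> y + y \<odot> D + D \<odot> (y \<odot> D)"
    unfolding K using D assms by (simp add: mult_add_left mult_add_right mult_assoc)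
  moreover have "nrm (D \<odot> y) \<le> k * nrm y"
    using op_norm_mult[of D y] mult_right_mono[OF D(2) op_norm_nonneg[of y]] by linarith
  moreover have yD: "nrm (y \<odot> D) \<le> k * nrm y"
    using op_norm_mult[of y D] mult_left_mono[OF D(2) op_norm_nonneg[of y]] by (simp add: mult.commute)
  moreover have "nrm (D \<odot> (y \<odot> D)) \<le> k * (k * nrm y)"
    using op_norm_mult[of D "y \<odot> D"] mult_mono[OF D(2) yD k] by simp
  ultimately have "nrm (K \<odot> y \<odot> K - y) \<le> k * nrm y + k * nrm y + k * (k * nrm y)"
    using op_norm_add[of "D \<odot> y + y \<odot> D" "D \<odot> (y \<odot> D)"] op_norm_add[of "D \<odot> y" "y \<odot> D"] by simp
  then show *: "nrm (K \<odot> y \<odot> K - y) \<le> ((1 + k)\<^sup>2 - 1) * nrm y"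
    by (simp add: power2_eq_square algebra_simps)
  have "nrm (K \<odot> y \<odot> K) \<le> nrm (K \<odot> y \<odot> K - y) + nrm y"
    using op_norm_add[of "K \<odot> y \<odot> K - y" y] by simp
  with * show "nrm (K \<odot> y \<odot> K) \<le> (1 + k)\<^sup>2 * nrm y"
    by (simp add: algebra_simps)
qed

subsection \<open>Fractional powers near the identity\<close>

text \<open>\<open>frac_pow a x\<close> is \<open>(1 + x)\<^sup>a\<close>, by the binomial series.\<close>

definition frac_pow :: "real \<Rightarrow> 'b opr \<Rightarrow> 'b opr" where
  "frac_pow a x = opser (\<lambda>n. a gchoose n) x"

text \<open>Consecutive coefficients have ratio (a - n) / (n + 1), of modulus at most 1 in this
  range. The binomial series is therefore dominated by the geometric one.\<close>

lemma abs_gbinomial_le_1: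
  assumes "\<bar>a\<bar> \<le> (1::real)" shows "\<bar>a gchoose n\<bar> \<le> 1"
proof (induction n)
  case (Suc n)
  have "a gchoose Suc n = (a gchoose n) * ((a - real n) / (real n + 1))"
    using gbinomial_mult_1[of a n] by (simp add: field_simps)
  moreover have "\<bar>(a - real n) / (real n + 1)\<bar> \<le> 1"
    using assms by (simp add: abs_le_iff divide_simps)
  ultimately show ?case
    using Suc mult_mono[of "\<bar>a gchoose n\<bar>" 1 "\<bar>(a - real n) / (real n + 1)\<bar>" 1] by (simp add: abs_mult)
qed simp

lemma summable_gbinomial:
  assumes "\<bar>a\<bar> \<le> (1::real)" "0 \<le> r" "r < 1"
  shows "summable (\<lambda>n. \<bar>a gchoose n\<bar> * r ^ n)" "(\<Sum>n. \<bar>a gchoose n\<bar> * r ^ n) \<le> 1 / (1 - r)"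
proof -
  have g: "summable (\<lambda>n. r ^ n)"
    using assms by (intro summable_geometric) auto
  have le: "\<bar>a gchoose n\<bar> * r ^ n \<le> r ^ n" for n
    using assms abs_gbinomial_le_1[of a n] by (intro mult_left_le_one_le) auto
  show s: "summable (\<lambda>n. \<bar>a gchoose n\<bar> * r ^ n)"
    by (rule summable_comparison_test'[OF g, of 0]) (use assms le in auto)
  show "(\<Sum>n. \<bar>a gchoose n\<bar> * r ^ n) \<le> 1 / (1 - r)"
    using suminf_le[OF le s g] assms suminf_geometric[of r] by simp
qed

lemma ser_conv_gbinomial: "x \<in> ops \<Longrightarrow> nrm x < 1 \<Longrightarrow> \<bar>a\<bar> \<le> 1 \<Longrightarrow> ser_conv (\<lambda>n. a gchoose n) x"
  unfolding ser_conv_def by (simp add: summable_gbinomial)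

lemma frac_pow_in_ops [simp]: "x \<in> ops \<Longrightarrow> nrm x < 1 \<Longrightarrow> \<bar>a\<bar> \<le> 1 \<Longrightarrow> frac_pow a x \<in> ops"
  by (simp add: frac_pow_def ser_conv_gbinomial)

lemma frac_pow_commute:
  "x \<in> ops \<Longrightarrow> nrm x < 1 \<Longrightarrow> \<bar>a\<bar> \<le> 1 \<Longrightarrow> y \<in> ops \<Longrightarrow> y \<odot> x = x \<odot> y \<Longrightarrow>
    y \<odot> frac_pow a x = frac_pow a x \<odot> y"
  by (simp add: frac_pow_def ser_conv_gbinomial opser_commute)

lemma adj_frac_pow:
  "x \<in> ops \<Longrightarrow> nrm x < 1 \<Longrightarrow> \<bar>a\<bar> \<le> 1 \<Longrightarrow> adj x = x \<Longrightarrow> adj (frac_pow a x) = frac_pow a x"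
  by (simp add: frac_pow_def ser_conv_gbinomial adj_opser)

text \<open>Vandermonde's identity for generalised binomial coefficients makes exponents
  additive.\<close>

lemma frac_pow_mult:
  assumes "x \<in> ops" "nrm x < 1" "\<bar>a\<bar> \<le> 1" "\<bar>b\<bar> \<le> 1"
  shows "frac_pow a x \<odot> frac_pow b x = frac_pow (a + b) x"
  unfolding frac_pow_def using assms
  by (simp add: opser_mult ser_conv_gbinomial gbinomial_Vandermonde atMost_atLeast0)

lemma opser_finite:
  assumes "\<And>n. n > m \<Longrightarrow> c n = 0"
  shows "opser c x = (\<Sum>n\<le>m. op_scale (complex_of_real (c n)) (pow x n))"
  unfolding opser_def
proof (rule opsum_eqI)
  fix s t
  show "(\<lambda>n. op_scale (complex_of_real (c n)) (pow x n) s t) sums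
      (\<Sum>n\<le>m. op_scale (complex_of_real (c n)) (pow x n)) s t"
    unfolding sum_fun_apply by (rule sums_finite) (auto simp: op_scale_def assms)
qed

text \<open>At natural exponents the binomial series terminates, so the powers 0 and 1 are exact
  polynomials.\<close>

lemma gbinomial_eq_0_of_nat: "m < n \<Longrightarrow> real m gchoose n = 0"
  by (simp flip: binomial_gbinomial)

lemma frac_pow_0: "frac_pow 0 x = Id"
  unfolding frac_pow_def
  using gbinomial_eq_0_of_nat[of 0] by (subst opser_finite[of 0]) auto

lemma frac_pow_1: "x \<in> ops \<Longrightarrow> frac_pow 1 x = Id + x"
  unfolding frac_pow_def
  using gbinomial_eq_0_of_nat[of 1] by (subst opser_finite[of 1]) auto

lemma op_norm_frac_pow_minus_id:
  assumes "x \<in> ops" "nrm x \<le> r" "r < 1" "\<bar>a\<bar> \<le> 1"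
  shows "nrm (frac_pow a x - Id) \<le> 1 / (1 - r) - 1"
proof -
  have r: "0 \<le> r"
    using assms(2) op_norm_nonneg order_trans by blast
  show ?thesis
    using op_norm_opser_minus_head[OF assms(1,2), of "\<lambda>n. a gchoose n"]
      summable_gbinomial[OF assms(4) r assms(3)]
    by (simp add: frac_pow_def)
qed

subsection \<open>Exponentials of superoperators\<close>

text \<open>The series in \<open>S\<close> has nonnegative coefficients, so norm bounds for \<open>S\<close> carry over term by term,
  without the loss that the alternating signs of \<open>L = S - M\<close> would cause.\<close>

lemma superop_exp_shift:
  fixes M :: nat
  assumes L: "\<And>x. x \<in> ops \<Longrightarrow> L x = S x - op_scale (of_nat M) x"
    and S: "\<And>x. x \<in> ops \<Longrightarrow> S x \<in> ops" "\<And>x. x \<in> ops \<Longrightarrow> nrm (S x) \<le> C * nrm x" "0 \<le> C"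
    and S_diff: "\<And>x y. x \<in> ops \<Longrightarrow> y \<in> ops \<Longrightarrow> S (x - y) = S x - S y"
    and S_scale: "\<And>x c. x \<in> ops \<Longrightarrow> S (op_scale c x) = op_scale c (S x)"
    and x: "x \<in> ops" and t: "0 \<le> t"
  shows "abs_summable (\<lambda>n. op_scale (complex_of_real (t ^ n / fact n)) ((S ^^ n) x))" (is "abs_summable ?X")
    and "superop_exp t L x = op_scale (complex_of_real (exp (- (real M * t))))
      (opsum (\<lambda>n. op_scale (complex_of_real (t ^ n / fact n)) ((S ^^ n) x)))"
proof -
  have Sn: "(S ^^ n) y \<in> ops" "nrm ((S ^^ n) y) \<le> C ^ n * nrm y" if "y \<in> ops" for n y
  proof (induction n)
    case (Suc n)
    { case 1 show ?case using Suc by (simp add: S) }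
    { case 2
      show ?case
        using S(2)[OF Suc(1)] mult_left_mono[OF Suc(2) S(3)] by (simp add: mult_ac) }
  qed (use that in auto)
  \<comment> \<open>Stated for the shape that \<open>L\<close> produces, so that iterates of
    \<open>S\<close> can be pushed through one step of \<open>L\<close>.\<close>
  have Sn_diff: "(S ^^ n) (y - op_scale c z) = (S ^^ n) y - op_scale c ((S ^^ n) z)"
    if "y \<in> ops" "z \<in> ops" for n c y z
  proof (induction n)
    case (Suc n)
    have "(S ^^ Suc n) (y - op_scale c z) = S ((S ^^ n) y - op_scale c ((S ^^ n) z))"
      by (simp only: funpow.simps o_apply Suc)
    then show ?case
      using that by (simp only: funpow.simps o_apply S_diff S_scale Sn operators_scale)
  qed simp
  have Ln: "(L ^^ n) x \<in> ops" for n
  proof (induction n)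
    case (Suc n)
    then show ?case
      by (simp only: funpow.simps o_apply L S operators_diff operators_scale)
  qed (simp add: x)
  show X: "abs_summable ?X"
  proof (rule abs_summableI)
    show "nrm (?X n) \<le> (\<bar>1 / fact n\<bar> * (t * C) ^ n) * nrm x" for n
    proof -
      have "nrm (?X n) \<le> (t ^ n / fact n) * nrm ((S ^^ n) x)"
        using op_norm_scale_le[of "complex_of_real (t ^ n / fact n)" "(S ^^ n) x"] t
        by (simp add: norm_divide norm_power)
      also have "\<dots> \<le> (t ^ n / fact n) * (C ^ n * nrm x)"
        using Sn(2)[OF x] t by (intro mult_left_mono) auto
      finally show ?thesis
        by (simp add: power_mult_distrib)
    qed
    show "summable (\<lambda>n. (\<bar>1 / fact n\<bar> * (t * C) ^ n) * nrm x)"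
      using exp_coeff_sums by (intro summable_mult2) (rule sums_summable)
  qed (simp add: Sn x)
  show "superop_exp t L x = op_scale (complex_of_real (exp (- (real M * t)))) (opsum ?X)"
  proof (intro ext)
    fix s u
    \<comment> \<open>Applying \<open>S\<close> commutes with multiplying by -M, so one more
      \<open>L\<close> means either one more \<open>S\<close> or one more factor -M.\<close>
    define W where "W = (\<lambda>n k j. (- of_nat M) ^ j * (S ^^ k) ((L ^^ n) x) s u)"
    have "W (Suc n) k j = W n (Suc k) j + W n k (Suc j)" for n k j
    proof -
      have "(S ^^ k) ((L ^^ Suc n) x) = (S ^^ Suc k) ((L ^^ n) x) - op_scale (of_nat M) ((S ^^ k) ((L ^^ n) x))"
        by (simp only: funpow.simps(2)[of n L] o_apply L Ln Sn_diff S funpow_Suc_right[of k S])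
      then show ?thesis
        by (simp only: W_def) (simp add: op_scale_def algebra_simps)
    qed
    from binomial_expansion_of_recurrence[of W, OF this, of _ 0 0]
    have Ln_eq: "(L ^^ n) x s u =
        (\<Sum>i\<le>n. of_nat (n choose i) * ((- of_nat M) ^ (n - i) * (S ^^ i) x s u))" for n
      by (simp add: W_def)
    define z where "z = complex_of_real (- (real M * t))"
    have "complex_of_real (t ^ n / fact n) * (L ^^ n) x s u =
        (\<Sum>i\<le>n. ?X i s u * (z ^ (n - i) /\<^sub>R fact (n - i)))" for n
      unfolding Ln_eq sum_distrib_left
    proof (intro sum.cong refl)
      fix i assume "i \<in> {..n}"
      then have "complex_of_real (t ^ n) = of_real t ^ i * of_real t ^ (n - i)"
        by (simp flip: power_add)
      moreover have "z ^ (n - i) = (- of_nat M) ^ (n - i) * of_real t ^ (n - i)"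
        by (simp add: z_def flip: power_mult_distrib)
      moreover have "(of_nat (n choose i) :: complex) = fact n / (fact i * fact (n - i))"
        using \<open>i \<in> {..n}\<close> by (intro binomial_fact) simp
      ultimately show "complex_of_real (t ^ n / fact n) *
          (of_nat (n choose i) * ((- of_nat M) ^ (n - i) * (S ^^ i) x s u)) =
          ?X i s u * (z ^ (n - i) /\<^sub>R fact (n - i))"
        by (simp add: op_scale_def scaleR_conv_of_real field_simps)
    qed
    then have "superop_exp t L x s u = (\<Sum>n. \<Sum>i\<le>n. ?X i s u * (z ^ (n - i) /\<^sub>R fact (n - i)))"
      by (simp add: superop_exp_def)
    \<comment> \<open>The Cauchy product separates the series in \<open>S\<close> from the scalar
      exponential of -M t.\<close>
    also have "\<dots> = opsum ?X s u * (\<Sum>n. z ^ n /\<^sub>R fact n)"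
      unfolding opsum_def
      by (rule sums_unique[symmetric], rule Cauchy_product_sums)
        (rule abs_summable_entries[OF X], rule summable_norm_exp)
    also have "(\<Sum>n. z ^ n /\<^sub>R fact n) = complex_of_real (exp (- (real M * t)))"
      unfolding z_def exp_of_real[symmetric] unfolding exp_def ..
    finally show "superop_exp t L x s u =
        op_scale (complex_of_real (exp (- (real M * t)))) (opsum ?X) s u"
      by (simp add: op_scale_def)
  qed
qed

end

section \<open>Quantum spin systems\<close>

locale spin_system =
  fixes V :: "'v set" and d :: nat
  assumes finite_sites: "finite V" and d_pos: "0 < d"
begin

abbreviation \<Omega> :: "('v \<Rightarrow> nat) set" where "\<Omega> \<equiv> configs V d"

end

sublocale spin_system \<subseteq> fin_basis "configs V d"
  by unfold_locales (simp add: configs_def finite_PiE finite_sites)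

context spin_system
begin

notation mult (infixl "\<odot>" 70)

section \<open>Changing and restricting configurations at one site\<close>

lemma configs_upd [simp]: "s \<in> \<Omega> \<Longrightarrow> v \<in> V \<Longrightarrow> a < d \<Longrightarrow> s(v := a) \<in> \<Omega>"
  unfolding configs_def by (auto simp: PiE_iff extensional_def)

lemma configs_less: "s \<in> \<Omega> \<Longrightarrow> v \<in> V \<Longrightarrow> s v < d"
  by (auto simp: configs_def)

lemma configs_restrict: "s \<in> \<Omega> \<Longrightarrow> restrict s (V - {v}) \<in> configs (V - {v}) d"
  by (auto simp: configs_def PiE_iff)

lemma restrict_site_upd: "s \<in> \<Omega> \<Longrightarrow> v \<in> V \<Longrightarrow> (restrict s (V - {v}))(v := a) = s(v := a)"
  unfolding configs_def by (intro ext) (auto simp: PiE_iff extensional_def)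

lemma configs_extend: "s \<in> configs (V - {v}) d \<Longrightarrow> v \<in> V \<Longrightarrow> a < d \<Longrightarrow> s(v := a) \<in> \<Omega>"
  unfolding configs_def by (auto simp: PiE_iff extensional_def)

lemma restrict_extend: "s \<in> configs (V - {v}) d \<Longrightarrow> restrict (s(v := a)) (V - {v}) = s"
  unfolding configs_def by (intro ext) (auto simp: PiE_iff extensional_def)

subsection \<open>Averaging over one site\<close>

abbreviation avg :: "'v \<Rightarrow> ('v \<Rightarrow> nat) opr \<Rightarrow> ('v \<Rightarrow> nat) opr" where
  "avg v \<equiv> tau V d v"

text \<open>Restricting to the other sites and then updating at \<open>v\<close> is the same as
  updating at \<open>v\<close>, so the passage to the smaller system and back disappears from the
  entries.\<close>

lemma avg_apply:
  assumes "v \<in> V"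
  shows "avg v x s t =
    (if s \<in> \<Omega> \<and> t \<in> \<Omega> \<and> s v = t v then (\<Sum>a<d. x (s(v := a)) (t(v := a))) / of_nat d else 0)"
proof -
  have "V - (V - {v}) = {v}"
    using assms by auto
  then show ?thesis
    using assms
    by (simp add: tau_def op_scale_def tensor_id_def partial_trace_def configs_restrict restrict_site_upd
        del: restrict_upd)
qed

lemma avg_in_ops [simp]: "v \<in> V \<Longrightarrow> avg v x \<in> ops"
  by (auto simp: operators_def avg_apply split: if_splits)

lemma avg_diff: "v \<in> V \<Longrightarrow> avg v (x - y) = avg v x - avg v y"
  by (intro ext) (simp add: avg_apply sum_subtractf diff_divide_distrib)

lemma avg_scale: "v \<in> V \<Longrightarrow> avg v (op_scale c x) = op_scale c (avg v x)"
  by (intro ext) (simp add: avg_apply op_scale_def sum_distrib_left)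

lemma avg_sum: "v \<in> V \<Longrightarrow> avg v (\<Sum>i\<in>I. f i) = (\<Sum>i\<in>I. avg v (f i))"
proof (intro ext)
  fix s t assume v: "v \<in> V"
  show "avg v (\<Sum>i\<in>I. f i) s t = (\<Sum>i\<in>I. avg v (f i)) s t"
    by (cases "s \<in> \<Omega> \<and> t \<in> \<Omega> \<and> s v = t v")
      (auto simp: v avg_apply sum_fun_apply sum.swap[of _ I] sum_divide_distrib)
qed

lemma avg_opsum:
  assumes "v \<in> V" "abs_summable X" shows "avg v (opsum X) = opsum (\<lambda>n. avg v (X n))"
  by (rule opsum_eqI[symmetric])
    (auto simp: avg_apply assms intro!: sums_divide sums_sum opsum_sums)

lemma adj_avg: "v \<in> V \<Longrightarrow> adj (avg v x) = avg v (adj x)"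
  by (intro ext) (auto simp: adj_def avg_apply)

lemma avg_id [simp]: "v \<in> V \<Longrightarrow> avg v Id = Id"
proof (intro ext)
  fix s t assume v: "v \<in> V"
  have "s(v := a) = t(v := a) \<longleftrightarrow> s = t" if "s v = t v" for a :: nat and s t :: "'v \<Rightarrow> nat"
    using that by (metis fun_upd_triv fun_upd_upd)
  then show "avg v Id s t = Id s t"
    using v d_pos by (auto simp: avg_apply op_id_def)
qed

lemma avg_avg [simp]:
  assumes "v \<in> V" shows "avg v (avg v x) = avg v x"
  using assms d_pos by (intro ext) (auto simp: avg_apply)

lemma avg_commute:
  assumes "v \<in> V" "w \<in> V" shows "avg v (avg w x) = avg w (avg v x)"
proof (cases "v = w")
  case False
  show ?thesis
  proof (intro ext)
    fix s t
    show "avg v (avg w x) s t = avg w (avg v x) s t"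
    proof (cases "s \<in> \<Omega> \<and> t \<in> \<Omega> \<and> s v = t v \<and> s w = t w")
      case True
      then show ?thesis
        using assms False
        by (simp add: avg_apply sum_divide_distrib[symmetric] fun_upd_twist[of v w])
          (subst sum.swap, simp)
    next
      case no: False
      then show ?thesis
        using assms False by (auto simp: avg_apply)
    qed
  qed
qed simp

text \<open>For the pair (a, b) this is the matrix unit |a><b| at site \<open>v\<close>, tensored
  with the identity elsewhere.\<close>

definition unit_at :: "'v \<Rightarrow> nat \<times> nat \<Rightarrow> ('v \<Rightarrow> nat) opr" where
  "unit_at v p = (\<lambda>s t. if s \<in> \<Omega> \<and> t \<in> \<Omega> \<and> t v = snd p \<and> s = t(v := fst p) then 1 else 0)"

lemma unit_at_in_ops [simp]: "unit_at v p \<in> ops"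
  by (auto simp: operators_def unit_at_def split: if_splits)

lemma adj_unit_at: "adj (unit_at v (a, b)) = unit_at v (b, a)"
proof (intro ext)
  fix s t :: "'v \<Rightarrow> nat"
  have "s v = b \<and> t = s(v := a) \<longleftrightarrow> t v = a \<and> s = t(v := b)"
    by (metis fun_upd_same fun_upd_triv fun_upd_upd)
  then show "adj (unit_at v (a, b)) s t = unit_at v (b, a) s t"
    by (auto simp: adj_def unit_at_def)
qed

lemma mult_unit_at:
  assumes "v \<in> V" "a < d" "t \<in> \<Omega>"
  shows "(x \<odot> unit_at v (a, b)) s t = (if t v = b then x s (t(v := a)) else 0)"
proof -
  have "(x \<odot> unit_at v (a, b)) s t =
      (\<Sum>u\<in>\<Omega>. if u = t(v := a) then (if t v = b then x s (t(v := a)) else 0) else 0)"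
    unfolding op_mult_def using assms by (intro sum.cong) (auto simp: unit_at_def)
  then show ?thesis
    using finite_basis assms by simp
qed

lemma unit_at_mult:
  assumes "v \<in> V" "b < d" "s \<in> \<Omega>"
  shows "(unit_at v (a, b) \<odot> x) s t = (if s v = a then x (s(v := b)) t else 0)"
proof -
  have eq: "u v = b \<and> s = u(v := a) \<longleftrightarrow> s v = a \<and> u = s(v := b)" for u
    by (metis fun_upd_same fun_upd_triv fun_upd_upd)
  have "(unit_at v (a, b) \<odot> x) s t =
      (\<Sum>u\<in>\<Omega>. if u = s(v := b) then (if s v = a then x (s(v := b)) t else 0) else 0)"
    unfolding op_mult_def using assms by (intro sum.cong) (auto simp: unit_at_def eq)
  then show ?thesis
    using finite_basis assms by simp
qed

text \<open>Conjugating with all d^2 matrix units at \<open>v\<close> traces that site out and puts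
  the identity in its place. This Kraus form yields both contractivity and the bimodule property of
  the average.\<close>

lemma avg_kraus:
  assumes "v \<in> V" "x \<in> ops"
  shows "avg v x = op_scale (1 / of_nat d)
    (\<Sum>p\<in>{..<d} \<times> {..<d}. adj (unit_at v p) \<odot> x \<odot> unit_at v p)"
proof (rule operators_eqI[of _ \<Omega>])
  fix s t assume st: "s \<in> \<Omega>" "t \<in> \<Omega>"
  have "(\<Sum>p\<in>{..<d} \<times> {..<d}. adj (unit_at v p) \<odot> x \<odot> unit_at v p) s t =
      (\<Sum>(a, b)\<in>{..<d} \<times> {..<d}. (if b = t v then (if s v = t v then x (s(v := a)) (t(v := a)) else 0) else 0))"
    unfolding sum_fun_apply
    using assms st by (intro sum.cong) (auto simp: adj_unit_at mult_unit_at unit_at_mult)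
  also have "\<dots> = (\<Sum>a<d. if s v = t v then x (s(v := a)) (t(v := a)) else 0)"
    unfolding sum.cartesian_product[symmetric]
    using configs_less[OF st(2) assms(1)] by simp
  finally show "avg v x s t = op_scale (1 / of_nat d)
    (\<Sum>p\<in>{..<d} \<times> {..<d}. adj (unit_at v p) \<odot> x \<odot> unit_at v p) s t"
    using assms st by (auto simp: avg_apply op_scale_def)
qed (use assms in auto)

text \<open>A Kraus map with operators d^(-1/2) E e G, where e runs through the matrix units at
  \<open>v\<close>. The hypothesis \<open>unital\<close> is exactly the normalisation of these
  operators.\<close>

lemma op_norm_sandwich_avg_le:
  assumes v: "v \<in> V" and E: "E \<in> ops" "adj E = E" and G: "G \<in> ops" "adj G = G"
    and unital: "G \<odot> avg v (E \<odot> E) \<odot> G = Id" and x: "x \<in> ops"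
  shows "nrm (G \<odot> avg v (E \<odot> x \<odot> E) \<odot> G) \<le> nrm x"
proof -
  define c where "c = complex_of_real (1 / sqrt (real d))"
  define K where "K = (\<lambda>p. op_scale c (E \<odot> unit_at v p \<odot> G))"
  have c: "cnj c * c = 1 / of_nat d"
  proof -
    have "cnj c * c = complex_of_real ((1 / sqrt (real d)) * (1 / sqrt (real d)))"
      unfolding c_def complex_cnj_complex_of_real of_real_mult ..
    also have "(1 / sqrt (real d)) * (1 / sqrt (real d)) = 1 / real d"
      by simp
    finally show ?thesis
      by simp
  qed
  have kraus: "G \<odot> avg v (E \<odot> y \<odot> E) \<odot> G =
      (\<Sum>p\<in>{..<d} \<times> {..<d}. adj (K p) \<odot> y \<odot> K p)" if "y \<in> ops" for y
    using that E G v
    by (simp add: avg_kraus K_def mult_sum_left mult_sum_right op_scale_sum adj_scale adj_mult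
        mult_assoc c[unfolded mult.commute[of _ c]])
  have "(\<Sum>p\<in>{..<d} \<times> {..<d}. adj (K p) \<odot> K p) = Id"
    using kraus[of Id] unital E by (simp add: K_def adj_scale adj_mult mult_assoc G)
  then show ?thesis
    using op_norm_kraus_le[of K "{..<d} \<times> {..<d}" x] by (simp add: kraus x)
qed

lemma op_norm_avg: "v \<in> V \<Longrightarrow> x \<in> ops \<Longrightarrow> nrm (avg v x) \<le> nrm x"
  using op_norm_sandwich_avg_le[of v Id Id x] by simp

subsection \<open>Operators acting trivially on a site\<close>

text \<open>The operators of the form k \<otimes> 1 with the identity at \<open>v\<close>, encoded
  as fixed points of the average so that closure properties reduce to identities for
  \<open>avg\<close>.\<close>

definition away :: "'v \<Rightarrow> ('v \<Rightarrow> nat) opr set" where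
  "away v = {x \<in> ops. avg v x = x}"

lemma away_in_ops: "x \<in> away v \<Longrightarrow> x \<in> ops"
  by (simp add: away_def)

lemma away_avg: "x \<in> away v \<Longrightarrow> avg v x = x"
  by (simp add: away_def)

lemma avg_in_away: "v \<in> V \<Longrightarrow> avg v x \<in> away v"
  by (simp add: away_def)

lemma away_eq_0: "x \<in> away v \<Longrightarrow> v \<in> V \<Longrightarrow> s v \<noteq> t v \<Longrightarrow> x s t = 0"
  unfolding away_def by (metis (mono_tags, lifting) avg_apply mem_Collect_eq)

lemma away_upd:
  assumes "x \<in> away v" "v \<in> V" "s \<in> \<Omega>" "t \<in> \<Omega>" "s v = t v" "a < d"
  shows "x (s(v := a)) (t(v := a)) = x s t"
proof -
  have "x s t = avg v x s t" "x (s(v := a)) (t(v := a)) = avg v x (s(v := a)) (t(v := a))"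
    using assms away_avg by metis+
  then show ?thesis
    using assms by (simp add: avg_apply)
qed

text \<open>Entries of such an operator vanish unless both configurations agree at \<open>v\<close>,
  and then they do not depend on the common value.\<close>

lemma away_commute_unit_at:
  assumes x: "x \<in> away v" "v \<in> V" and ab: "a < d" "b < d"
  shows "x \<odot> unit_at v (a, b) = unit_at v (a, b) \<odot> x"
proof (rule operators_eqI[of _ \<Omega>])
  fix s t assume st: "s \<in> \<Omega>" "t \<in> \<Omega>"
  have "x s (t(v := a)) = x (s(v := b)) t" if "s v = a" "t v = b"
    using away_upd[of x v s "t(v := a)" b] that st x ab
    by (simp add: fun_upd_idem[of t v])
  moreover have "x s (t(v := a)) = 0" if "s v \<noteq> a"
    using away_eq_0[OF x(1)] x that by simp
  moreover have "x (s(v := b)) t = 0" if "t v \<noteq> b"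
    using away_eq_0[OF x(1)] x that by simp
  ultimately show "(x \<odot> unit_at v (a, b)) s t = (unit_at v (a, b) \<odot> x) s t"
    using st x ab by (auto simp: mult_unit_at unit_at_mult)
qed (use x in \<open>auto simp: away_in_ops\<close>)

text \<open>The bimodule property of a conditional expectation: \<open>a\<close> commutes with the
  matrix units at \<open>v\<close> and can be pulled out of each Kraus term.\<close>

lemma avg_mult_left:
  assumes "a \<in> away v" "v \<in> V" "x \<in> ops" shows "avg v (a \<odot> x) = a \<odot> avg v x"
proof -
  have "adj (unit_at v p) \<odot> (a \<odot> x) \<odot> unit_at v p = a \<odot> (adj (unit_at v p) \<odot> x \<odot> unit_at v p)"
    if "p \<in> {..<d} \<times> {..<d}" for p
    using that assms away_commute_unit_at[of a v "snd p" "fst p"]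
    by (cases p) (simp add: adj_unit_at mult_assoc[symmetric])
  then show ?thesis
    using assms by (simp add: avg_kraus away_in_ops mult_sum_right)
qed

lemma avg_mult_right:
  assumes "a \<in> away v" "v \<in> V" "x \<in> ops" shows "avg v (x \<odot> a) = avg v x \<odot> a"
proof -
  have "adj (unit_at v p) \<odot> (x \<odot> a) \<odot> unit_at v p = (adj (unit_at v p) \<odot> x \<odot> unit_at v p) \<odot> a"
    if "p \<in> {..<d} \<times> {..<d}" for p
    using that assms away_commute_unit_at[of a v "fst p" "snd p"]
    by (cases p) (simp add: adj_unit_at mult_assoc)
  then show ?thesis
    using assms by (simp add: avg_kraus away_in_ops mult_sum_left)
qed

lemma away_id: "v \<in> V \<Longrightarrow> Id \<in> away v"
  by (simp add: away_def)

lemma away_diff: "v \<in> V \<Longrightarrow> x \<in> away v \<Longrightarrow> y \<in> away v \<Longrightarrow> x - y \<in> away v"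
  by (simp add: away_def avg_diff)

lemma away_scale: "v \<in> V \<Longrightarrow> x \<in> away v \<Longrightarrow> op_scale c x \<in> away v"
  by (simp add: away_def avg_scale)

lemma away_sum: "v \<in> V \<Longrightarrow> (\<And>i. i \<in> I \<Longrightarrow> f i \<in> away v) \<Longrightarrow> (\<Sum>i\<in>I. f i) \<in> away v"
  by (simp add: away_def avg_sum)

lemma away_mult: "v \<in> V \<Longrightarrow> x \<in> away v \<Longrightarrow> y \<in> away v \<Longrightarrow> x \<odot> y \<in> away v"
  using avg_mult_left[of x v y] by (simp add: away_def)

lemma away_avg_away: "v \<in> V \<Longrightarrow> w \<in> V \<Longrightarrow> x \<in> away v \<Longrightarrow> avg w x \<in> away v"
  by (simp add: away_def avg_commute[of v w])

lemma away_opsum: "v \<in> V \<Longrightarrow> abs_summable X \<Longrightarrow> (\<And>n. X n \<in> away v) \<Longrightarrow> opsum X \<in> away v"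
  by (simp add: away_def avg_opsum)

lemma away_pow: "v \<in> V \<Longrightarrow> x \<in> away v \<Longrightarrow> pow x n \<in> away v"
  by (induction n) (auto simp: away_mult away_id)

lemma away_opser: "v \<in> V \<Longrightarrow> x \<in> away v \<Longrightarrow> ser_conv c x \<Longrightarrow> opser c x \<in> away v"
  unfolding opser_def by (intro away_opsum abs_summable_opser away_scale away_pow)

lemma away_op_exp: "v \<in> V \<Longrightarrow> x \<in> away v \<Longrightarrow> op_exp \<Omega> x \<in> away v"
  unfolding op_exp_eq_opser by (intro away_opser ser_conv_exp away_in_ops)

lemma away_frac_pow:
  "v \<in> V \<Longrightarrow> x \<in> away v \<Longrightarrow> nrm x < 1 \<Longrightarrow> \<bar>a\<bar> \<le> 1 \<Longrightarrow> frac_pow a x \<in> away v"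
  unfolding frac_pow_def by (intro away_opser ser_conv_gbinomial away_in_ops)

section \<open>Operators supported on a set of sites\<close>

lemma tensor_id_in_ops: "tensor_id V d A k \<in> ops"
  by (auto simp: operators_def tensor_id_def split: if_splits)

lemma supported_on_in_ops: "supported_on V d A x \<Longrightarrow> x \<in> ops"
  unfolding supported_on_def using tensor_id_in_ops by auto

lemma supported_on_away:
  assumes "supported_on V d A x" "v \<in> V" "v \<notin> A" shows "x \<in> away v"
proof -
  obtain k where x: "x = tensor_id V d A k"
    using assms(1) by (auto simp: supported_on_def)
  have r: "restrict (s(v := a)) A = restrict s A" for s :: "'v \<Rightarrow> nat" and a
    using assms(3) by (intro ext) auto
  have "avg v x s t = x s t" for s t
  proof (cases "s \<in> \<Omega> \<and> t \<in> \<Omega> \<and> s v = t v")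
    case True
    have "(\<forall>u\<in>V - A. (s(v := a)) u = (t(v := a)) u) \<longleftrightarrow> (\<forall>u\<in>V - A. s u = t u)" for a
      using True by auto
    then have "x (s(v := a)) (t(v := a)) = x s t" if "a < d" for a
      unfolding x tensor_id_def r using True assms(2) that by simp
    then show ?thesis
      using True assms d_pos by (simp add: avg_apply)
  next
    case False
    then show ?thesis
      using assms by (auto simp: avg_apply x tensor_id_def)
  qed
  then have "avg v x = x"
    by (intro ext)
  then show ?thesis
    using tensor_id_in_ops by (simp add: away_def x)
qed

text \<open>Induction over the sites of \<open>A\<close>, replacing the common values of
  \<open>s\<close> and \<open>t\<close> by those of \<open>p\<close> one site at a time.\<close>

lemma away_override:
  assumes "finite A" "A \<subseteq> V" "\<And>v. v \<in> A \<Longrightarrow> y \<in> away v"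
    and "s \<in> \<Omega>" "t \<in> \<Omega>" "p \<in> \<Omega>" "\<forall>v\<in>A. s v = t v"
  shows "override_on s p A \<in> \<Omega> \<and> override_on t p A \<in> \<Omega> \<and>
    y (override_on s p A) (override_on t p A) = y s t"
  using assms
proof (induction A)
  case (insert v A)
  let ?s = "override_on s p A" and ?t = "override_on t p A"
  have IH: "?s \<in> \<Omega>" "?t \<in> \<Omega>" "y ?s ?t = y s t"
    using insert by auto
  have "?s v = ?t v" "v \<in> V" "y \<in> away v" "p v < d"
    using insert.hyps insert.prems by (auto simp: configs_less)
  then show ?case
    using IH away_upd[of y v ?s ?t "p v"] by (simp only: override_on_insert configs_upd simp_thms)
qed simp

lemma supported_on_commute:
  assumes x: "supported_on V d A x" and A: "A \<subseteq> V" and y: "\<And>v. v \<in> A \<Longrightarrow> y \<in> away v" "y \<in> ops"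
  shows "x \<odot> y = y \<odot> x"
proof (rule operators_eqI[of _ \<Omega>])
  obtain k where k: "x = tensor_id V d A k"
    using x by (auto simp: supported_on_def)
  fix s t assume st: "s \<in> \<Omega>" "t \<in> \<Omega>"
  \<comment> \<open>In an entry of \<open>x \<odot> y\<close> the factor \<open>x\<close> keeps the
    sites outside \<open>A\<close> and \<open>y\<close> keeps those inside, so a single intermediate
    configuration survives: \<open>p\<close>, equal to \<open>t\<close> on \<open>A\<close> and to
    \<open>s\<close> elsewhere. For \<open>y \<odot> x\<close> it is \<open>q\<close>, with the
    roles exchanged.\<close>
  define p where "p = override_on s t A"
  define q where "q = override_on t s A"
  have pq: "p \<in> \<Omega>" "q \<in> \<Omega>"
    using st A by (auto simp: p_def q_def configs_def PiE_iff override_on_def extensional_def)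
  have zero: "y r r' = 0" if "\<not> (\<forall>v\<in>A. r v = r' v)" for r r'
    using that y A away_eq_0 by blast
  have "(x \<odot> y) s t = (\<Sum>r\<in>\<Omega>. if r = p then x s p * y p t else 0)"
    unfolding op_mult_def
  proof (intro sum.cong refl)
    fix r assume "r \<in> \<Omega>"
    have eq: "r = p" if "\<forall>u\<in>V - A. s u = r u" "\<forall>v\<in>A. r v = t v"
    proof (rule PiE_ext)
      show "r \<in> V \<rightarrow>\<^sub>E {..<d}" "p \<in> V \<rightarrow>\<^sub>E {..<d}"
        using \<open>r \<in> \<Omega>\<close> pq by (simp_all add: configs_def)
    qed (use that in \<open>auto simp: p_def override_on_def\<close>)
    show "x s r * y r t = (if r = p then x s p * y p t else 0)"
    proof (cases "r = p")
      case False
      then have "x s r = 0 \<or> y r t = 0"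
        using eq zero[of r t] unfolding k tensor_id_def by meson
      then show ?thesis
        using False by auto
    qed simp
  qed
  also have "\<dots> = x s p * y p t"
    using pq finite_basis by simp
  \<comment> \<open>The factors match separately: \<open>y\<close> is insensitive to the common
    values on \<open>A\<close>, and \<open>x\<close> sees only the values on
    \<open>A\<close>.\<close>
  also have "\<dots> = y s q * x q t"
  proof -
    have "override_on p s A = s" "override_on t s A = q"
      by (auto simp: p_def q_def override_on_def)
    then have "y p t = y s q"
      using away_override[of A y p t s] st pq A y(1) finite_subset[OF A finite_sites]
      by (simp add: p_def)
    moreover have "x s p = x q t"
    proof -
      have "restrict s A = restrict q A" "restrict p A = restrict t A"
        by (auto simp: p_def q_def)
      then show ?thesis
        using st pq by (simp add: k tensor_id_def) (auto simp: p_def q_def)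
    qed
    ultimately show ?thesis
      by simp
  qed
  also have "\<dots> = (\<Sum>r\<in>\<Omega>. if r = q then y s q * x q t else 0)"
    using pq finite_basis by simp
  also have "\<dots> = (y \<odot> x) s t"
    unfolding op_mult_def
  proof (intro sum.cong refl)
    fix r assume "r \<in> \<Omega>"
    have eq: "r = q" if "\<forall>u\<in>V - A. r u = t u" "\<forall>v\<in>A. s v = r v"
    proof (rule PiE_ext)
      show "r \<in> V \<rightarrow>\<^sub>E {..<d}" "q \<in> V \<rightarrow>\<^sub>E {..<d}"
        using \<open>r \<in> \<Omega>\<close> pq by (simp_all add: configs_def)
    qed (use that in \<open>auto simp: q_def override_on_def\<close>)
    show "(if r = q then y s q * x q t else 0) = y s r * x r t"
    proof (cases "r = q")
      case False
      then have "y s r = 0 \<or> x r t = 0"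
        using eq zero[of s r] unfolding k tensor_id_def by meson
      then show ?thesis
        using False by auto
    qed simp
  qed
  finally show "(x \<odot> y) s t = (y \<odot> x) s t" .
qed (use supported_on_in_ops[OF x] y in auto)

subsection \<open>The heat-bath map as a sandwiched average\<close>

lemma embed_apply:
  assumes "v \<in> V"
  shows "tensor_id V d (V - {v}) k s t =
    (if s \<in> \<Omega> \<and> t \<in> \<Omega> \<and> s v = t v then k (restrict s (V - {v})) (restrict t (V - {v})) else 0)"
proof -
  have "V - (V - {v}) = {v}"
    using assms by auto
  then show ?thesis
    by (simp add: tensor_id_def)
qed

text \<open>Identities on the smaller system can thus be checked after embedding, in the algebra of
  the full system.\<close>

lemma embed_inject:
  assumes v: "v \<in> V" and k: "k \<in> operators (configs (V - {v}) d)" "l \<in> operators (configs (V - {v}) d)"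
    and eq: "tensor_id V d (V - {v}) k = tensor_id V d (V - {v}) l"
  shows "k = l"
proof (rule operators_eqI[OF k])
  fix s t assume st: "s \<in> configs (V - {v}) d" "t \<in> configs (V - {v}) d"
  \<comment> \<open>The value 0 at \<open>v\<close> is admissible because \<open>d\<close> is
    positive.\<close>
  from fun_cong[OF fun_cong[OF eq], of "s(v := 0)" "t(v := 0)"]
  show "k s t = l s t"
    using st v d_pos by (simp add: embed_apply configs_extend restrict_extend del: restrict_fupd)
qed

text \<open>Nonzero terms of the product keep the value at \<open>v\<close>; for a fixed value
  there, the configurations of \<open>V\<close> correspond to those of
  \<open>V - {v}\<close>.\<close>

lemma embed_mult:
  assumes v: "v \<in> V"
  shows "tensor_id V d (V - {v}) (op_mult (configs (V - {v}) d) k l) =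
    tensor_id V d (V - {v}) k \<odot> tensor_id V d (V - {v}) l"
proof (rule operators_eqI[of _ \<Omega>])
  fix s t assume st: "s \<in> \<Omega>" "t \<in> \<Omega>"
  let ?C = "configs (V - {v}) d" and ?r = "\<lambda>s. restrict s (V - {v})"
  show "tensor_id V d (V - {v}) (op_mult ?C k l) s t =
      (tensor_id V d (V - {v}) k \<odot> tensor_id V d (V - {v}) l) s t"
  proof (cases "s v = t v")
    case True
    have sv: "s v < d"
      using st v by (simp add: configs_less)
    have "(tensor_id V d (V - {v}) k \<odot> tensor_id V d (V - {v}) l) s t =
        (\<Sum>u\<in>{u \<in> \<Omega>. u v = s v}. k (?r s) (?r u) * l (?r u) (?r t))"
      unfolding op_mult_def using v st True finite_basis
      by (intro sum.mono_neutral_cong_right) (auto simp: embed_apply)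
    also have "\<dots> = (\<Sum>u\<in>?C. k (?r s) u * l u (?r t))"
    proof (rule sum.reindex_bij_witness[of _ "\<lambda>u. u(v := s v)" ?r])
      fix u assume u: "u \<in> {u \<in> \<Omega>. u v = s v}"
      then show "(?r u)(v := s v) = u" "?r u \<in> ?C"
        using v restrict_site_upd[of u v "s v"]
        by (auto simp: configs_restrict fun_upd_idem simp del: restrict_upd)
    qed (use v sv in \<open>auto simp: restrict_extend configs_extend simp del: restrict_fupd\<close>)
    finally show ?thesis
      using v st True by (simp add: embed_apply op_mult_def)
  next
    case False
    then have "(tensor_id V d (V - {v}) k \<odot> tensor_id V d (V - {v}) l) s t = 0"
      unfolding op_mult_def using v by (intro sum.neutral) (auto simp: embed_apply)
    then show ?thesis
      using v False by (simp add: embed_apply)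
  qed
qed (simp_all add: tensor_id_in_ops)

lemma embed_id:
  assumes v: "v \<in> V" shows "tensor_id V d (V - {v}) (op_id (configs (V - {v}) d)) = Id"
proof (rule operators_eqI[of _ \<Omega>])
  fix s t assume st: "s \<in> \<Omega>" "t \<in> \<Omega>"
  have "restrict s (V - {v}) = restrict t (V - {v}) \<and> s v = t v \<longleftrightarrow> s = t"
    using restrict_site_upd[OF st(1) v, of "s v"] restrict_site_upd[OF st(2) v, of "s v"]
    by (metis fun_upd_triv)
  then show "tensor_id V d (V - {v}) (op_id (configs (V - {v}) d)) s t = Id s t"
    using st v by (auto simp: embed_apply op_id_def configs_restrict)
qed (simp_all add: tensor_id_in_ops)

lemma embed_adj: "v \<in> V \<Longrightarrow> tensor_id V d (V - {v}) (adj k) = adj (tensor_id V d (V - {v}) k)"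
  by (intro ext) (auto simp: embed_apply adj_def)

lemma embed_scale: "tensor_id V d A (op_scale c k) = op_scale c (tensor_id V d A k)"
  by (intro ext) (simp add: tensor_id_def op_scale_def)

lemma embed_partial_trace:
  "v \<in> V \<Longrightarrow> tensor_id V d (V - {v}) (partial_trace V d v x) = op_scale (of_nat d) (avg v x)"
  using d_pos by (simp add: tau_def)

lemma partial_trace_in_ops: "partial_trace V d v x \<in> operators (configs (V - {v}) d)"
  by (auto simp: operators_def partial_trace_def split: if_splits)

lemma away_embed:
  assumes "v \<in> V" "x \<in> away v"
  obtains k where "k \<in> operators (configs (V - {v}) d)" "tensor_id V d (V - {v}) k = x"
proof
  show "op_scale (1 / of_nat d) (partial_trace V d v x) \<in> operators (configs (V - {v}) d)"
    by (simp add: partial_trace_in_ops)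
  show "tensor_id V d (V - {v}) (op_scale (1 / of_nat d) (partial_trace V d v x)) = x"
    using assms d_pos by (simp add: embed_scale embed_partial_trace away_avg)
qed

text \<open>\<open>S\<close> is a square root of the embedded reduced state, \<open>w\<close> a
  fourth root and \<open>Q\<close> the inverse of \<open>S\<close>. All of them act trivially on
  \<open>v\<close>, so they descend to the smaller system, where uniqueness evaluates the
  descriptions behind \<open>op_sqrt\<close> and \<open>op_inverse\<close>.\<close>

lemma heat_bath_map_eq:
  assumes v: "v \<in> V" and w: "w \<in> away v" "adj w = w" and w': "w' \<in> away v" "w' \<odot> w = Id"
    and S: "S = w \<odot> w" "S \<odot> S = op_scale (of_nat d) (avg v \<omega>)"
    and Q: "Q \<in> away v" "S \<odot> Q = Id" "Q \<odot> S = Id"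
    and r: "op_sqrt \<Omega> \<omega> = r"
  shows "heat_bath_map V d \<omega> v x = Q \<odot> op_scale (of_nat d) (avg v (r \<odot> x \<odot> r)) \<odot> Q"
proof -
  let ?C = "configs (V - {v}) d" and ?e = "tensor_id V d (V - {v})"
  interpret C: fin_basis ?C
    by unfold_locales (simp add: configs_def finite_PiE finite_sites)
  obtain w0 where w0: "w0 \<in> operators ?C" "?e w0 = w"
    using away_embed[OF v w(1)] .
  obtain w0' where w0': "w0' \<in> operators ?C" "?e w0' = w'"
    using away_embed[OF v w'(1)] .
  obtain Q0 where Q0: "Q0 \<in> operators ?C" "?e Q0 = Q"
    using away_embed[OF v Q(1)] .
  define S0 where "S0 = op_mult ?C w0 w0"
  have S0: "S0 \<in> operators ?C" "?e S0 = S"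
    using w0 v by (simp_all add: S0_def S(1) embed_mult)
  have "adj w0 = w0"
    by (rule embed_inject[OF v, rotated 2]) (use v w0 w in \<open>simp_all add: embed_adj\<close>)
  moreover have "op_mult ?C w0' w0 = op_id ?C"
     by (rule embed_inject[OF v, rotated 2]) (use v w0 w0' w' in \<open>simp_all add: embed_mult embed_id\<close>)
  ultimately have "op_sqrt ?C (op_mult ?C S0 S0) = S0"
    using w0 w0' by (intro C.op_sqrt_eq[of w0 w0']) (simp_all add: S0_def)
  moreover have "op_mult ?C S0 S0 = partial_trace V d v \<omega>"
     by (rule embed_inject[OF v, rotated 2])
      (use v S0 in \<open>simp_all add: embed_mult embed_partial_trace partial_trace_in_ops S(2)\<close>)
  moreover have "op_inverse ?C S0 = Q0"
  proof (rule C.op_inverse_eq)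
    show "op_mult ?C S0 Q0 = op_id ?C" "op_mult ?C Q0 S0 = op_id ?C"
      by (rule embed_inject[OF v]; use v S0 Q0 Q in \<open>simp add: embed_mult embed_id\<close>)+
  qed (rule Q0)
  ultimately show ?thesis
    using v Q0 by (simp add: heat_bath_map_def Let_def r embed_mult embed_partial_trace)
qed

lemma sqrt_sqrt_power4: "0 \<le> x \<Longrightarrow> sqrt (sqrt x) ^ 4 = x"
  using power_mult[of "sqrt (sqrt x)" 2 2] by simp

lemma id_nonzero: "Id \<noteq> (0 :: ('v \<Rightarrow> nat) opr)"
proof
  assume "Id = (0 :: ('v \<Rightarrow> nat) opr)"
  moreover have "restrict (\<lambda>_. 0) V \<in> \<Omega>"
    using d_pos by (simp add: configs_def)
  ultimately show False
    by (metis op_id_def one_neq_zero zero_fun_apply)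
qed

text \<open>The partition function is the squared Hilbert-Schmidt norm of exp(-\<beta> H / 2), an
  invertible operator. It is therefore positive and has real roots.\<close>

lemma gibbs_state_sqrt:
  assumes "H \<in> ops" "adj H = H"
  obtains c where "c > 0"
    "gibbs_state V d H \<beta> = op_scale (complex_of_real (c ^ 4)) (expo (- \<beta>) H)"
    "op_sqrt \<Omega> (gibbs_state V d H \<beta>) = op_scale (complex_of_real (c\<^sup>2)) (expo (- \<beta> / 2) H)"
proof -
  define g where "g = expo (- \<beta> / 2) H"
  define z where "z = (\<Sum>s\<in>\<Omega>. \<Sum>u\<in>\<Omega>. (cmod (g u s))\<^sup>2)"
  have g: "g \<in> ops" "adj g = g" "g \<odot> g = expo (- \<beta>) H"
    using assms by (simp_all add: g_def adj_expo expo_mult)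
  have tr: "op_trace \<Omega> (expo (- \<beta>) H) = complex_of_real z"
    using trace_adj_mult[of g] by (simp add: g z_def)
  have "z \<noteq> 0"
  proof
    assume "z = 0"
    then have "g = 0"
      using g tr by (intro trace_adj_mult_eq_0) auto
    then have "expo (\<beta> / 2) H \<odot> g = 0"
      by simp
    then show False
      using id_nonzero assms by (simp add: g_def expo_mult)
  qed
  then have z: "z > 0"
    unfolding z_def by (simp add: less_le sum_nonneg)
  \<comment> \<open>The fourth root of 1 / z, because \<open>op_sqrt_eq\<close> asks for a fourth
    root \<open>w\<close> of the state.\<close>
  define c where "c = 1 / sqrt (sqrt z)"
  have c: "c > 0" "c ^ 4 = 1 / z"
    using z by (simp_all add: c_def power_one_over sqrt_sqrt_power4)
  have \<omega>: "gibbs_state V d H \<beta> = op_scale (complex_of_real (c ^ 4)) (expo (- \<beta>) H)"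
    using tr c by (simp add: gibbs_state_def Let_def expo_def)
  define w where "w = op_scale (complex_of_real c) (expo (- \<beta> / 4) H)"
  define w' where "w' = op_scale (complex_of_real (1 / c)) (expo (\<beta> / 4) H)"
  define r where "r = op_scale (complex_of_real (c\<^sup>2)) (expo (- \<beta> / 2) H)"
  have "op_sqrt \<Omega> (r \<odot> r) = r"
  proof (rule op_sqrt_eq[of w w'])
    show "w \<in> ops" "w' \<in> ops" "adj w = w" "w' \<odot> w = Id" "r = w \<odot> w"
      using assms c
      by (simp_all add: w_def w'_def r_def adj_scale adj_expo expo_mult power2_eq_square)
  qed
  moreover have "r \<odot> r = gibbs_state V d H \<beta>"
    using assms by (simp add: r_def \<omega> expo_mult power4_eq_xxxx power2_eq_square mult.assoc)
  ultimately show ?thesis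
    using that c(1) \<omega> r_def by metis
qed

end

text \<open>\<open>a\<close> collects the interaction terms that touch the site \<open>v\<close>.\<close>

locale heat_bath_site = spin_system V d for V :: "'v set" and d :: nat +
  fixes v :: 'v and a :: "('v \<Rightarrow> nat) opr" and \<beta> h :: real
  assumes v: "v \<in> V" and a: "a \<in> operators (configs V d)" "adj a = a"
    and norm_a: "op_norm (configs V d) a \<le> h" and \<beta>: "0 \<le> \<beta>" and small: "exp (\<beta> * h) < 2"
begin

notation mult (infixl "\<odot>" 70)

definition boltz :: "('v \<Rightarrow> nat) opr" where "boltz = expo (- \<beta> / 2) a"

text \<open>The deviation from the identity of the averaged squared Boltzmann factor. The bound
  exp(\<beta> h) < 2 puts it into the open unit ball, where the binomial series defines the powers
  of \<open>Id + dev\<close>.\<close>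

definition dev :: "('v \<Rightarrow> nat) opr" where "dev = avg v (boltz \<odot> boltz) - Id"

definition local_map :: "('v \<Rightarrow> nat) opr \<Rightarrow> ('v \<Rightarrow> nat) opr" where
  "local_map x = frac_pow (- 1 / 2) dev \<odot> avg v (boltz \<odot> x \<odot> boltz) \<odot> frac_pow (- 1 / 2) dev"

section \<open>Properties of the local form of the heat-bath map\<close>

lemma boltz: "boltz \<in> ops" "adj boltz = boltz" "boltz \<odot> boltz = expo (- \<beta>) a"
  using a by (simp_all add: boltz_def adj_expo expo_mult)

lemma dev: "dev \<in> away v" "dev \<in> ops" "adj dev = dev"
  using v by (simp_all add: dev_def away_diff avg_in_away away_id adj_diff adj_avg adj_mult boltz(1,2))

lemma norm_dev: "nrm dev \<le> exp (\<beta> * h) - 1"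
proof -
  have "dev = avg v (boltz \<odot> boltz - Id)"
    using v by (simp add: dev_def avg_diff)
  then have "nrm dev \<le> nrm (boltz \<odot> boltz - Id)"
    using v boltz(1) op_norm_avg[of v "boltz \<odot> boltz - Id"] by simp
  also have "\<dots> \<le> exp (\<beta> * h) - 1"
    unfolding boltz(3) using a norm_a \<beta> by (intro op_norm_expo_minus_id) (auto intro: mult_left_mono)
  finally show ?thesis .
qed

lemma norm_dev_less: "nrm dev < 1"
  using norm_dev small by simp

lemma frac_dev_in_away: "\<bar>p\<bar> \<le> 1 \<Longrightarrow> frac_pow p dev \<in> away v"
  by (simp add: away_frac_pow v dev norm_dev_less)

lemma frac_dev: "\<bar>p\<bar> \<le> 1 \<Longrightarrow> frac_pow p dev \<in> ops" "\<bar>p\<bar> \<le> 1 \<Longrightarrow> adj (frac_pow p dev) = frac_pow p dev"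
  "\<bar>p\<bar> \<le> 1 \<Longrightarrow> \<bar>q\<bar> \<le> 1 \<Longrightarrow> frac_pow p dev \<odot> frac_pow q dev = frac_pow (p + q) dev"
  "frac_pow 0 dev = Id" "frac_pow 1 dev = avg v (boltz \<odot> boltz)"
  by (simp_all add: dev norm_dev_less adj_frac_pow frac_pow_mult frac_pow_0 frac_pow_1)
    (simp add: dev_def)

text \<open>Commuting with \<open>a\<close>, \<open>y\<close> commutes with the Boltzmann factor;
  acting trivially on \<open>v\<close>, it passes through the average. So it commutes with
  \<open>dev\<close> and with power series in it.\<close>

lemma commute_frac_dev:
  assumes y: "y \<in> away v" "y \<odot> a = a \<odot> y" and p: "\<bar>p\<bar> \<le> 1"
  shows "y \<odot> frac_pow p dev = frac_pow p dev \<odot> y"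
proof -
  have yops: "y \<in> ops"
    using y by (simp add: away_in_ops)
  have "y \<odot> avg v (boltz \<odot> boltz) = avg v (y \<odot> (boltz \<odot> boltz))"
    using y v boltz(1) by (simp add: avg_mult_left)
  also have "\<dots> = avg v (boltz \<odot> boltz \<odot> y)"
    unfolding boltz(3) expo_commute[OF a(1) yops y(2)] ..
  also have "\<dots> = avg v (boltz \<odot> boltz) \<odot> y"
    using y v boltz(1) by (simp add: avg_mult_right)
  finally have "y \<odot> dev = dev \<odot> y"
    using yops by (simp add: dev_def mult_diff_left mult_diff_right)
  then show ?thesis
    using yops p by (intro frac_pow_commute) (auto simp: dev norm_dev_less)
qed

text \<open>Once \<open>y\<close> is pulled out of all factors, powers of \<open>Id + dev\<close>
  with exponents -1/2, 1 and -1/2 remain, and these cancel.\<close>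

lemma local_map_fixed:
  assumes y: "y \<in> away v" "y \<odot> a = a \<odot> y"
  shows "local_map y = y"
proof -
  have yops: "y \<in> ops"
    using y by (simp add: away_in_ops)
  have "boltz \<odot> y \<odot> boltz = boltz \<odot> boltz \<odot> y"
    using expo_commute[OF a(1) yops y(2), of "- \<beta> / 2"] by (simp add: boltz_def mult_assoc)
  then have "avg v (boltz \<odot> y \<odot> boltz) = avg v (boltz \<odot> boltz) \<odot> y"
    using y v boltz(1) by (simp add: avg_mult_right)
  then have "local_map y = frac_pow (- 1 / 2) dev \<odot> frac_pow 1 dev \<odot> (y \<odot> frac_pow (- 1 / 2) dev)"
    by (simp add: local_map_def frac_dev mult_assoc)
  also have "\<dots> = frac_pow (- 1 / 2) dev \<odot> frac_pow 1 dev \<odot> frac_pow (- 1 / 2) dev \<odot> y"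
    using commute_frac_dev[OF y, of "- 1 / 2"] by (simp add: mult_assoc)
  also have "\<dots> = y"
    using frac_dev(3)[of "- 1 / 2" 1] frac_dev(3)[of "1 / 2" "- 1 / 2"] frac_dev(4) yops by simp
  finally show ?thesis .
qed

lemma local_map_in_away: "x \<in> ops \<Longrightarrow> local_map x \<in> away v"
  unfolding local_map_def by (intro away_mult v frac_dev_in_away avg_in_away) auto

lemma local_map_diff: "local_map (x - y) = local_map x - local_map y"
  using v by (simp add: local_map_def mult_diff_left mult_diff_right avg_diff)

lemma local_map_scale: "local_map (op_scale c x) = op_scale c (local_map x)"
  using v by (simp add: local_map_def avg_scale)

text \<open>Fixing the identity is the normalisation of the Kraus form.\<close>

lemma op_norm_local_map: "x \<in> ops \<Longrightarrow> nrm (local_map x) \<le> nrm x"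
  unfolding local_map_def
  using local_map_fixed[of Id] v a boltz frac_dev
  by (intro op_norm_sandwich_avg_le) (auto simp: away_id local_map_def)

text \<open>All factors inherit from \<open>a\<close> that they act trivially on \<open>u\<close>,
  and averages over sites commute.\<close>

lemma avg_local_map:
  assumes u: "u \<in> V" "a \<in> away u" and x: "x \<in> ops"
  shows "avg u (local_map x) = local_map (avg u x)"
proof -
  have b: "boltz \<in> away u"
    unfolding boltz_def expo_def using u by (intro away_op_exp away_scale)
  then have "dev \<in> away u"
    unfolding dev_def using u v by (intro away_diff away_avg_away away_mult away_id)
  then have f: "frac_pow (- 1 / 2) dev \<in> away u"
    using u by (simp add: away_frac_pow norm_dev_less)
  show ?thesis
    using u x v b f boltz(1) frac_dev(1)[of "- 1 / 2"]
    by (simp add: local_map_def avg_mult_left avg_mult_right avg_commute[of u v] mult_assoc)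
qed

text \<open>Two perturbations of the identity are removed in turn, first the outer normalising
  powers and then the inner Boltzmann factors. Their costs combine to (1 + f)^2 (1 + e)^2 -
  1.\<close>

lemma op_norm_local_map_minus_avg:
  assumes x: "x \<in> ops"
  shows "nrm (local_map x - avg v x) \<le> (exp (\<beta> * h) / (2 - exp (\<beta> * h))\<^sup>2 - 1) * nrm x"
proof -
  define e where "e = exp (\<beta> * h / 2) - 1"
  \<comment> \<open>This is 1 / (1 - r) - 1 for r = exp(\<beta> h) - 1, the bound on the norm of
    \<open>dev\<close>.\<close>
  define f where "f = 1 / (2 - exp (\<beta> * h)) - 1"
  define y where "y = avg v (boltz \<odot> x \<odot> boltz)"
  have y: "y \<in> ops"
    using v by (simp add: y_def)
  have e: "nrm (boltz - Id) \<le> e"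
    unfolding boltz_def e_def using a norm_a \<beta>
    by (intro op_norm_expo_minus_id) (auto intro: mult_left_mono)
  have f: "nrm (frac_pow (- 1 / 2) dev - Id) \<le> f"
    using op_norm_frac_pow_minus_id[OF dev(2) norm_dev, of "- 1 / 2"] small by (simp add: f_def)
  then have "0 \<le> f"
    using op_norm_nonneg order_trans by blast
  then have f': "0 \<le> (1 + f)\<^sup>2 - 1"
    by (simp add: power2_eq_square algebra_simps)
  have y_le: "nrm y \<le> (1 + e)\<^sup>2 * nrm x"
    using op_norm_sandwich_diff(2)[OF boltz(1) x e] op_norm_avg[of v "boltz \<odot> x \<odot> boltz"] v x boltz
    by (simp add: y_def)
  have "nrm (local_map x - y) \<le> ((1 + f)\<^sup>2 - 1) * nrm y"
    unfolding local_map_def y_def[symmetric]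
    using frac_dev(1)[of "- 1 / 2"] y f by (intro op_norm_sandwich_diff) auto
  also have "\<dots> \<le> ((1 + f)\<^sup>2 - 1) * ((1 + e)\<^sup>2 * nrm x)"
    by (rule mult_left_mono[OF y_le f'])
  finally have 1: "nrm (local_map x - y) \<le> ((1 + f)\<^sup>2 - 1) * ((1 + e)\<^sup>2 * nrm x)" .
  have "y - avg v x = avg v (boltz \<odot> x \<odot> boltz - x)"
    using v by (simp add: y_def avg_diff)
  then have 2: "nrm (y - avg v x) \<le> ((1 + e)\<^sup>2 - 1) * nrm x"
    using op_norm_sandwich_diff(1)[OF boltz(1) x e] op_norm_avg[of v "boltz \<odot> x \<odot> boltz - x"] v x boltz
    by simp
  have "(1 + f)\<^sup>2 * (1 + e)\<^sup>2 = exp (\<beta> * h) / (2 - exp (\<beta> * h))\<^sup>2"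
    by (simp add: f_def e_def power_divide exp_double[symmetric])
  moreover have "nrm (local_map x - avg v x) \<le> nrm (local_map x - y) + nrm (y - avg v x)"
    using op_norm_add[of "local_map x - y" "y - avg v x"] by simp
  ultimately show ?thesis
    using 1 2 by (simp add: algebra_simps)
qed

text \<open>The interaction \<open>b\<close> away from \<open>v\<close> cancels between \<open>\<omega>\<close> and its reduced state.\<close>

lemma heat_bath_map_eq_local_map:
  assumes b: "b \<in> away v" "adj b = b" "a \<odot> b = b \<odot> a" and x: "x \<in> ops"
  shows "heat_bath_map V d (gibbs_state V d (a + b) \<beta>) v x = local_map x"
proof -
  have bops: "b \<in> ops"
    using b by (simp add: away_in_ops)
  have adj_ab: "adj (a + b) = a + b"
    using a b by (intro ext) (simp add: adj_def fun_eq_iff)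
  obtain c where c: "c > 0"
    and \<omega>: "gibbs_state V d (a + b) \<beta> = op_scale (complex_of_real (c ^ 4)) (expo (- \<beta>) (a + b))"
    and r: "op_sqrt \<Omega> (gibbs_state V d (a + b) \<beta>) =
      op_scale (complex_of_real (c\<^sup>2)) (expo (- \<beta> / 2) (a + b))"
    using gibbs_state_sqrt[of "a + b" \<beta>] adj_ab a bops by (metis operators_add)
  define g where "g = (\<lambda>\<theta>. expo \<theta> b)"
  define f where "f = (\<lambda>p. frac_pow p dev)"
  \<comment> \<open>Embedding the partial trace gives \<open>d\<close> times the average, so a
    fourth root of the embedded reduced state carries the extra factor d^(1/4).\<close>
  define q where "q = sqrt (sqrt (real d))"
  define k where "k = c * q"
  have q: "q > 0" "q ^ 4 = real d"
    using d_pos by (simp_all add: q_def sqrt_sqrt_power4)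
  have k: "k > 0" "k ^ 4 = c ^ 4 * real d"
    using c q by (simp_all add: k_def power_mult_distrib)
  have g: "g \<theta> \<in> away v" "g \<theta> \<in> ops" "adj (g \<theta>) = g \<theta>" "g \<theta> \<odot> g \<phi> = g (\<theta> + \<phi>)" "g 0 = Id" for \<theta> \<phi>
    using b bops v
    by (simp_all add: g_def adj_expo expo_mult) (simp add: expo_def away_op_exp away_scale)
  have ga: "g \<theta> \<odot> a = a \<odot> g \<theta>" for \<theta>
    using expo_commute[OF bops a(1) b(3), of \<theta>] by (simp add: g_def)
  have f: "f p \<in> away v" "f p \<in> ops" "adj (f p) = f p" "g \<theta> \<odot> f p = f p \<odot> g \<theta>" if "\<bar>p\<bar> \<le> 1" for p \<theta>
    using that by (simp_all add: f_def frac_dev frac_dev_in_away commute_frac_dev g ga)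
  have fg: "(g \<theta> \<odot> f p) \<odot> (g \<phi> \<odot> f p') = g (\<theta> + \<phi>) \<odot> f (p + p')" if "\<bar>p\<bar> \<le> 1" "\<bar>p'\<bar> \<le> 1" for p p' \<theta> \<phi>
  proof -
    have "(g \<theta> \<odot> f p) \<odot> (g \<phi> \<odot> f p') = g \<theta> \<odot> (f p \<odot> g \<phi>) \<odot> f p'"
      by (simp add: mult_assoc)
    also have "\<dots> = (g \<theta> \<odot> g \<phi>) \<odot> (f p \<odot> f p')"
      unfolding f(4)[OF that(1), of \<phi>, symmetric] by (simp only: mult_assoc)
    finally show ?thesis
      using that by (simp add: g(4)) (simp add: f_def frac_dev)
  qed
  have f01: "f 0 = Id" "f 1 = avg v (boltz \<odot> boltz)"
    by (simp_all add: f_def frac_dev)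
  have split: "expo \<theta> (a + b) = expo \<theta> a \<odot> g \<theta>" "expo \<theta> a \<odot> g \<phi> = g \<phi> \<odot> expo \<theta> a" for \<theta> \<phi>
    using expo_add[OF a(1) bops b(3), of \<theta>] expo_commute[OF a(1) g(2) ga, of \<phi> \<theta>]
    by (simp_all add: g_def)
  \<comment> \<open>Fourth root, its inverse, square root and inverse square root of the embedded
    reduced state. Since \<open>g\<close> and \<open>f\<close> commute, exponents simply
    add.\<close>
  define w where "w = op_scale (complex_of_real k) (g (- \<beta> / 4) \<odot> f (1 / 4))"
  define w' where "w' = op_scale (complex_of_real (1 / k)) (g (\<beta> / 4) \<odot> f (- 1 / 4))"
  define S where "S = op_scale (complex_of_real (k\<^sup>2)) (g (- \<beta> / 2) \<odot> f (1 / 2))"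
  define Q where "Q = op_scale (complex_of_real (1 / k\<^sup>2)) (g (\<beta> / 2) \<odot> f (- 1 / 2))"
  have avg_\<omega>: "avg v (gibbs_state V d (a + b) \<beta>) =
      op_scale (complex_of_real (c ^ 4)) (g (- \<beta>) \<odot> f 1)"
    using v g(1) a(1) by (simp add: \<omega> split avg_scale avg_mult_left f01 boltz(3))
  have "heat_bath_map V d (gibbs_state V d (a + b) \<beta>) v x =
      Q \<odot> op_scale (of_nat d) (avg v (op_scale (complex_of_real (c\<^sup>2)) (expo (- \<beta> / 2) (a + b)) \<odot> x
        \<odot> op_scale (complex_of_real (c\<^sup>2)) (expo (- \<beta> / 2) (a + b)))) \<odot> Q"
  proof (rule heat_bath_map_eq[OF v, of w w' S])
    show "w \<in> away v" "w' \<in> away v" "Q \<in> away v"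
      using v f g by (simp_all add: w_def w'_def Q_def away_scale away_mult)
    show "adj w = w"
      using f(3,4)[of "1 / 4"] g(3) by (simp add: w_def adj_scale adj_mult)
    show "w' \<odot> w = Id" "S = w \<odot> w"
      using k by (simp_all add: w_def w'_def S_def fg g(5) f01 power2_eq_square)
    show "S \<odot> Q = Id" "Q \<odot> S = Id"
      using k by (simp_all add: S_def Q_def fg g(5) f01)
    have "S \<odot> S = op_scale (complex_of_real (k ^ 4)) (g (- \<beta>) \<odot> f 1)"
      by (simp add: S_def fg power4_eq_xxxx power2_eq_square mult.assoc)
    then show "S \<odot> S = op_scale (of_nat d) (avg v (gibbs_state V d (a + b) \<beta>))"
      unfolding avg_\<omega> k(2) by (simp add: mult.commute)
  qed (rule r)
  also have "\<dots> = local_map x"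
  proof -
    \<comment> \<open>The exponentials of \<open>b\<close> leave the average because
      \<open>b\<close> acts trivially on \<open>v\<close>; those inside \<open>Q\<close> then cancel
      them.\<close>
    have 1: "expo (- \<beta> / 2) (a + b) \<odot> x \<odot> expo (- \<beta> / 2) (a + b) =
        g (- \<beta> / 2) \<odot> (boltz \<odot> x \<odot> boltz) \<odot> g (- \<beta> / 2)"
      using split[of "- \<beta> / 2"] by (simp add: boltz_def mult_assoc)
    have 2: "avg v (expo (- \<beta> / 2) (a + b) \<odot> x \<odot> expo (- \<beta> / 2) (a + b)) =
        g (- \<beta> / 2) \<odot> avg v (boltz \<odot> x \<odot> boltz) \<odot> g (- \<beta> / 2)"
      unfolding 1 using v g x boltz by (simp add: avg_mult_left avg_mult_right)
    have gg: "g (\<beta> / 2) \<odot> g (- \<beta> / 2) = Id" "g (- \<beta> / 2) \<odot> g (\<beta> / 2) = Id"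
      by (simp_all add: g)
    have fh: "f (- 1 / 2) \<in> ops" "g (\<beta> / 2) \<odot> f (- 1 / 2) = f (- 1 / 2) \<odot> g (\<beta> / 2)"
      by (rule f, simp)+
    have 3: "(g (\<beta> / 2) \<odot> f (- 1 / 2)) \<odot> g (- \<beta> / 2) = f (- 1 / 2)"
      by (simp only: fh mult_assoc gg mult_id_right)
    have gf: "g (- \<beta> / 2) \<odot> (g (\<beta> / 2) \<odot> f (- 1 / 2)) = f (- 1 / 2)"
      by (simp only: mult_assoc[symmetric] gg fh(1) mult_id_left)
    have "(g (\<beta> / 2) \<odot> f (- 1 / 2)) \<odot>
        (g (- \<beta> / 2) \<odot> avg v (boltz \<odot> x \<odot> boltz) \<odot> g (- \<beta> / 2)) \<odot> (g (\<beta> / 2) \<odot> f (- 1 / 2)) =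
        ((g (\<beta> / 2) \<odot> f (- 1 / 2)) \<odot> g (- \<beta> / 2)) \<odot> avg v (boltz \<odot> x \<odot> boltz) \<odot>
        (g (- \<beta> / 2) \<odot> (g (\<beta> / 2) \<odot> f (- 1 / 2)))"
      by (simp only: mult_assoc)
    also have "\<dots> = local_map x"
      unfolding 3 gf by (simp add: local_map_def f_def)
    finally have 4: "(g (\<beta> / 2) \<odot> f (- 1 / 2)) \<odot>
        (g (- \<beta> / 2) \<odot> avg v (boltz \<odot> x \<odot> boltz) \<odot> g (- \<beta> / 2)) \<odot> (g (\<beta> / 2) \<odot> f (- 1 / 2)) =
        local_map x" .
    \<comment> \<open>Two factors c^2 from the root of the state, \<open>d\<close> from the partial
      trace and k^(-2) from each \<open>Q\<close> cancel since k^4 = c^4 d.\<close>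
    have "complex_of_real (1 / k\<^sup>2) * (of_nat d * (complex_of_real (c\<^sup>2) * complex_of_real (c\<^sup>2))) *
        complex_of_real (1 / k\<^sup>2) = complex_of_real (c ^ 4 * real d / k ^ 4)"
      by (simp add: power4_eq_xxxx power2_eq_square mult_ac)
    also have "\<dots> = 1"
      unfolding k(2) using c d_pos by simp
    finally show ?thesis
      using 2 4 v by (simp add: Q_def avg_scale mult_ac)
  qed
  finally show ?thesis .
qed

end

section \<open>Commuting interactions\<close>

locale commuting_system = spin_system V d for V :: "'v set" and d :: nat +
  fixes E :: "'v set set" and \<delta> :: "'v \<Rightarrow> 'v \<Rightarrow> real" and R N :: nat
    and h :: "'v set \<Rightarrow> ('v \<Rightarrow> nat) opr" and \<beta> :: real
  assumes hypergraph: "finite_hypergraph V E" and range: "finite_range V E \<delta> R N"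
    and interaction: "commuting_interaction V E d h"
    and \<beta>: "0 \<le> \<beta>" and small: "exp (\<beta> * 2 ^ N) < 2"
begin

notation mult (infixl "\<odot>" 70)

abbreviation nbhd :: "'v \<Rightarrow> 'v set" where "nbhd v \<equiv> Metric_space.mcball V \<delta> v (real R)"

abbreviation Psi :: "'v \<Rightarrow> ('v \<Rightarrow> nat) opr \<Rightarrow> ('v \<Rightarrow> nat) opr" where
  "Psi \<equiv> heat_bath_map V d (gibbs_state V d (\<Sum>A\<in>E. h A) \<beta>)"

abbreviation lip :: "('v \<Rightarrow> nat) opr \<Rightarrow> real" where "lip \<equiv> lipschitz_norm V d"

text \<open>The constant of \<open>op_norm_local_map_minus_avg\<close> for the norm bound 2^N on the
  terms touching a site.\<close>

definition eps :: real where "eps = exp (\<beta> * 2 ^ N) / (2 - exp (\<beta> * 2 ^ N))\<^sup>2 - 1"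

definition touching :: "'v \<Rightarrow> ('v \<Rightarrow> nat) opr" where
  "touching v = (\<Sum>A\<in>{A \<in> E. v \<in> A}. h A)"

definition rest :: "'v \<Rightarrow> ('v \<Rightarrow> nat) opr" where
  "rest v = (\<Sum>A\<in>{A \<in> E. v \<notin> A}. h A)"

section \<open>Geometry of the hypergraph and splitting of the Hamiltonian at a site\<close>

lemma edges: "finite E" "A \<in> E \<Longrightarrow> A \<subseteq> V" "V \<noteq> {}"
  using hypergraph finite_subset[of E "Pow V"] by (auto simp: finite_hypergraph_def finite_sites)

lemma interaction_term:
  assumes "A \<in> E"
  shows "h A \<in> ops" "adj (h A) = h A" "supported_on V d A (h A)" "nrm (h A) \<le> 1"
    "A' \<in> E \<Longrightarrow> h A \<odot> h A' = h A' \<odot> h A"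
  using assms interaction supported_on_in_ops
  by (auto simp: commuting_interaction_def self_adjoint_iff_adj)

lemma nbhd_iff: "u \<in> nbhd v \<longleftrightarrow> v \<in> V \<and> u \<in> V \<and> \<delta> v u \<le> real R"
proof -
  interpret Metric_space V \<delta>
    using range by (simp add: finite_range_def)
  show ?thesis
    by (simp add: in_mcball)
qed

lemma nbhd:
  assumes "v \<in> V"
  shows "v \<in> nbhd v" "nbhd v \<subseteq> V" "finite (nbhd v)" "card (nbhd v) \<le> N"
    "u \<in> nbhd v \<Longrightarrow> v \<in> nbhd u" "A \<in> E \<Longrightarrow> v \<in> A \<Longrightarrow> A \<subseteq> nbhd v"
proof -
  interpret Metric_space V \<delta>
    using range by (simp add: finite_range_def)
  show "nbhd v \<subseteq> V"
    by (auto simp: nbhd_iff)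
  then show "finite (nbhd v)"
    using finite_sites finite_subset by blast
  show "card (nbhd v) \<le> N"
    using range assms by (simp add: finite_range_def)
  show "v \<in> nbhd v" "u \<in> nbhd v \<Longrightarrow> v \<in> nbhd u"
    using assms by (auto simp: nbhd_iff commute)
  show "A \<subseteq> nbhd v" if "A \<in> E" "v \<in> A"
    using that assms range edges(2)[OF that(1)] by (auto simp: nbhd_iff finite_range_def)
qed

text \<open>Hyperedges containing \<open>v\<close> are subsets of a ball with at most
  \<open>N\<close> sites, so there are at most 2^N of them, each contributing norm at most 1.
  Pairwise commutation passes to the two partial sums.\<close>

lemma touching:
  assumes "v \<in> V"
  shows "touching v \<in> ops" "adj (touching v) = touching v" "nrm (touching v) \<le> 2 ^ N"
    "rest v \<in> away v" "adj (rest v) = rest v" "touching v \<odot> rest v = rest v \<odot> touching v"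
    "touching v + rest v = (\<Sum>A\<in>E. h A)"
proof -
  have "nrm (touching v) \<le> (\<Sum>A\<in>{A \<in> E. v \<in> A}. 1)"
    unfolding touching_def by (intro order_trans[OF op_norm_sum] sum_mono interaction_term(4)) auto
  also have "\<dots> = card {A \<in> E. v \<in> A}"
    by simp
  also have "card {A \<in> E. v \<in> A} \<le> card (Pow (nbhd v))"
    using assms nbhd[OF assms] by (intro card_mono) auto
  also have "\<dots> = 2 ^ card (nbhd v)"
    using nbhd[OF assms] by (simp add: card_Pow)
  also have "real (2 ^ card (nbhd v)) \<le> 2 ^ N"
    using nbhd(4)[OF assms] by simp
  finally show "nrm (touching v) \<le> 2 ^ N"
    by simp
  show "touching v \<in> ops" "adj (touching v) = touching v" "adj (rest v) = rest v"
    by (auto simp: touching_def rest_def adj_sum interaction_term intro!: operators_sum sum.cong)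
  show "rest v \<in> away v"
    unfolding rest_def using assms interaction_term(3) by (intro away_sum) (auto intro: supported_on_away)
  show "touching v \<odot> rest v = rest v \<odot> touching v"
    unfolding touching_def rest_def mult_sum_left mult_sum_right
    by (subst sum.swap) (auto intro!: sum.cong interaction_term)
  have "E = {A \<in> E. v \<in> A} \<union> {A \<in> E. v \<notin> A}"
    by auto
  then show "touching v + rest v = (\<Sum>A\<in>E. h A)"
    unfolding touching_def rest_def using edges(1)
    by (subst sum.union_disjoint[symmetric]) auto
qed

lemma heat_bath_site: "v \<in> V \<Longrightarrow> heat_bath_site V d v (touching v) \<beta> (2 ^ N)"
  by unfold_locales (simp_all add: touching \<beta> small)

text \<open>Everything that the contraction estimate uses about the heat-bath maps, transferred from
  the local form at each site.\<close>

lemma Psi: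
  assumes "v \<in> V" "x \<in> ops"
  shows "Psi v x \<in> away v" "nrm (Psi v x) \<le> nrm x"
    "y \<in> ops \<Longrightarrow> Psi v (x - y) = Psi v x - Psi v y"
    "Psi v (op_scale c x) = op_scale c (Psi v x)"
    "u \<in> V \<Longrightarrow> u \<notin> nbhd v \<Longrightarrow> avg u (Psi v x) = Psi v (avg u x)"
    "(\<And>u. u \<in> nbhd v \<Longrightarrow> x \<in> away u) \<Longrightarrow> Psi v x = x"
    "nrm (Psi v x - avg v x) \<le> eps * nrm x"
proof -
  interpret L: heat_bath_site V d v "touching v" \<beta> "2 ^ N"
    by (rule heat_bath_site[OF assms(1)])
  have eq: "Psi v z = L.local_map z" if "z \<in> ops" for z
    using L.heat_bath_map_eq_local_map[OF touching(4,5,6)[OF assms(1)] that]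
    by (simp add: touching(7)[OF assms(1)])
  show "Psi v x \<in> away v" "nrm (Psi v x) \<le> nrm x"
    "y \<in> ops \<Longrightarrow> Psi v (x - y) = Psi v x - Psi v y"
    "Psi v (op_scale c x) = op_scale c (Psi v x)"
    "nrm (Psi v x - avg v x) \<le> eps * nrm x"
    using assms
    by (simp_all add: eq L.local_map_in_away L.op_norm_local_map L.local_map_diff
        L.local_map_scale L.op_norm_local_map_minus_avg eps_def)
  show "avg u (Psi v x) = Psi v (avg u x)" if "u \<in> V" "u \<notin> nbhd v"
  proof -
    \<comment> \<open>All hyperedges containing \<open>v\<close> lie in its ball and hence avoid
      \<open>u\<close>.\<close>
    have "touching v \<in> away u"
      unfolding touching_def
      using that nbhd(6)[OF assms(1)] interaction_term(3)
      by (intro away_sum) (auto intro!: supported_on_away)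
    then show ?thesis
      using assms that by (simp add: eq L.avg_local_map)
  qed
  show "Psi v x = x" if "\<And>u. u \<in> nbhd v \<Longrightarrow> x \<in> away u"
  proof -
    \<comment> \<open>Each hyperedge at \<open>v\<close> lies in the ball where \<open>x\<close>
      acts trivially, so the terms commute with \<open>x\<close> one by one.\<close>
    have "x \<odot> touching v = touching v \<odot> x"
      unfolding touching_def mult_sum_left mult_sum_right
    proof (intro sum.cong refl)
      fix A assume "A \<in> {A \<in> E. v \<in> A}"
      then show "x \<odot> h A = h A \<odot> x"
        using nbhd(6)[OF assms(1)] that assms(2) edges(2)
        by (intro supported_on_commute[symmetric, OF interaction_term(3)]) auto
    qed
    then show ?thesis
      using that nbhd(1) assms by (simp add: eq L.local_map_fixed)
  qed
qed

section \<open>Oscillations and the Lipschitz seminorm\<close>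

lemma op_norm_osc_le_lip: "v \<in> V \<Longrightarrow> nrm (x - avg v x) \<le> lip x"
  unfolding lipschitz_norm_def using finite_sites by (intro Max_ge) auto

lemma lip_leI: "(\<And>v. v \<in> V \<Longrightarrow> nrm (x - avg v x) \<le> c) \<Longrightarrow> lip x \<le> c"
  unfolding lipschitz_norm_def using finite_sites edges(3) by (intro Max.boundedI) auto

lemma lip_nonneg: "0 \<le> lip x"
  using edges(3) op_norm_osc_le_lip[of _ x] op_norm_nonneg order_trans by (metis ex_in_conv)

text \<open>The witness is \<open>x\<close> averaged over all sites of \<open>S\<close>.\<close>

lemma away_approximation:
  assumes "finite S" "S \<subseteq> V" "x \<in> ops"
  shows "\<exists>y\<in>ops. (\<forall>u\<in>S. y \<in> away u) \<and> nrm (x - y) \<le> (\<Sum>u\<in>S. nrm (x - avg u x))"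
  using assms
proof (induction S)
  case empty
  show ?case
  proof (rule bexI[of _ x], rule conjI)
    show "nrm (x - x) \<le> (\<Sum>u\<in>{}. nrm (x - avg u x))"
      by (simp only: sum.empty diff_self op_norm_zero order.refl)
  qed (use empty in auto)
next
  case (insert v S)
  obtain y where y: "y \<in> ops" "\<forall>u\<in>S. y \<in> away u" "nrm (x - y) \<le> (\<Sum>u\<in>S. nrm (x - avg u x))"
    using insert.IH insert.prems by blast
  have v: "v \<in> V"
    using insert by auto
  have "x - avg v y = (x - avg v x) + avg v (x - y)"
    using v by (simp add: avg_diff)
  moreover have "nrm (avg v (x - y)) \<le> nrm (x - y)"
    using v y insert.prems by (intro op_norm_avg) auto
  ultimately have "nrm (x - avg v y) \<le> nrm (x - avg v x) + nrm (x - y)"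
    using op_norm_add[of "x - avg v x" "avg v (x - y)"] by (simp only:)
  then have "nrm (x - avg v y) \<le> (\<Sum>u\<in>insert v S. nrm (x - avg u x))"
    using y(3) insert.hyps by simp
  moreover have "\<forall>u\<in>insert v S. avg v y \<in> away u"
    using insert.prems y v by (auto simp: avg_in_away intro: away_avg_away)
  ultimately show ?case
    using avg_in_ops[OF v] by blast
qed

lemma eps_nonneg: "0 \<le> eps"
proof -
  have "0 < (2 - exp (\<beta> * 2 ^ N))\<^sup>2" "(2 - exp (\<beta> * 2 ^ N))\<^sup>2 \<le> 1" "1 \<le> exp (\<beta> * 2 ^ N)"
    using small \<beta> by (auto simp: power_le_one)
  then have "(2 - exp (\<beta> * 2 ^ N))\<^sup>2 \<le> exp (\<beta> * 2 ^ N)" "0 < (2 - exp (\<beta> * 2 ^ N))\<^sup>2"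
    by linarith+
  then show ?thesis
    unfolding eps_def by simp
qed

text \<open>For u = v the image acts trivially on \<open>u\<close>, and far from \<open>v\<close>
  the average at \<open>u\<close> commutes with the map. In the remaining case the map is compared
  with the average at \<open>v\<close>.\<close>

lemma op_norm_osc_Psi:
  assumes u: "u \<in> V" and v: "v \<in> V" and x: "x \<in> ops"
  shows "nrm (Psi v x - avg u (Psi v x)) \<le>
    (if u = v then 0 else lip x + (if u \<in> nbhd v then 2 * eps * N * lip x else 0))"
proof -
  consider "u = v" | "u \<notin> nbhd v" "u \<noteq> v" | "u \<in> nbhd v" "u \<noteq> v"
    by blast
  then show ?thesis
  proof cases
    case 1
    then have "Psi v x - avg u (Psi v x) = 0"
      using Psi(1)[OF v x] by (simp add: away_avg)
    then show ?thesis
      using 1 by simp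
  next
    case 2
    have "Psi v x - avg u (Psi v x) = Psi v (x - avg u x)"
      using 2 u v x by (simp add: Psi)
    then show ?thesis
      using 2 u v x Psi(2)[of v "x - avg u x"] op_norm_osc_le_lip[OF u, of x] by simp
  next
    case 3
    obtain y where y: "y \<in> ops" "\<forall>w\<in>nbhd v. y \<in> away w"
      "nrm (x - y) \<le> (\<Sum>w\<in>nbhd v. nrm (x - avg w x))"
      using away_approximation[OF nbhd(3,2)[OF v] x] by blast
    have "(\<Sum>w\<in>nbhd v. nrm (x - avg w x)) \<le> (\<Sum>w\<in>nbhd v. lip x)"
      using nbhd(2)[OF v] by (intro sum_mono op_norm_osc_le_lip) auto
    also have "\<dots> \<le> N * lip x"
      using nbhd(4)[OF v] lip_nonneg by (simp add: mult_right_mono)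
    finally have xy: "nrm (x - y) \<le> N * lip x"
      using y(3) by simp
    \<comment> \<open>Both maps fix \<open>y\<close>, so the error sees only x - y. This matters
      because the norm of \<open>x\<close> itself is not controlled by \<open>lip x\<close>.\<close>
    define D where "D = Psi v x - avg v x"
    have "D = Psi v (x - y) - avg v (x - y)"
      using v x y nbhd(1)[OF v] by (simp add: D_def Psi(3) avg_diff Psi(6) away_avg)
    then have "nrm D \<le> eps * nrm (x - y)"
      using Psi(7)[OF v, of "x - y"] x y by simp
    also have "\<dots> \<le> eps * (N * lip x)"
      by (rule mult_left_mono[OF xy eps_nonneg])
    finally have D: "nrm D \<le> eps * (N * lip x)" .
    have Dops: "D \<in> ops"
      using v x Psi(1)[OF v x] by (simp add: D_def away_in_ops)
    \<comment> \<open>The averages at \<open>u\<close> and \<open>v\<close> commute, which gives the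
      main term. The oscillation of \<open>D\<close> costs twice its norm, the origin of the factor
      2.\<close>
    have "Psi v x - avg u (Psi v x) = avg v (x - avg u x) + (D - avg u D)"
      using u v by (simp add: D_def avg_diff avg_commute[of u v])
    then have "nrm (Psi v x - avg u (Psi v x)) \<le> nrm (avg v (x - avg u x)) + (nrm D + nrm (avg u D))"
      using op_norm_add[of "avg v (x - avg u x)" "D - avg u D"] op_norm_diff[of D "avg u D"] by simp
    moreover have "nrm (avg v (x - avg u x)) \<le> lip x"
      using op_norm_avg[OF v, of "x - avg u x"] op_norm_osc_le_lip[OF u, of x] x u by simp
    moreover have "nrm (avg u D) \<le> nrm D"
      by (rule op_norm_avg[OF u Dops])
    ultimately show ?thesis
      using 3 D by simp
  qed
qed

text \<open>At most \<open>N\<close> sites near a given one, each with error 2 N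
  \<open>eps\<close>.\<close>

definition kappa :: real where "kappa = 2 * (real N)\<^sup>2 * eps"

definition total :: "('v \<Rightarrow> nat) opr \<Rightarrow> ('v \<Rightarrow> nat) opr" where "total x = (\<Sum>v\<in>V. Psi v x)"

section \<open>Contraction for the sum of the heat-bath maps and for the semigroup\<close>

lemma total_in_ops: "x \<in> ops \<Longrightarrow> total x \<in> ops"
  unfolding total_def using Psi(1) away_in_ops by (intro operators_sum) blast

text \<open>In the oscillation at \<open>u\<close> the term v = u drops out. This replaces the
  number of sites by one less and is the source of the decay.\<close>

lemma lip_total:
  assumes x: "x \<in> ops"
  shows "lip (total x) \<le> (card V - 1 + kappa) * lip x"
proof (rule lip_leI)
  fix u assume u: "u \<in> V"
  define K where "K = 2 * eps * N * lip x"
  have K: "0 \<le> K"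
    unfolding K_def by (intro mult_nonneg_nonneg eps_nonneg lip_nonneg) simp_all
  have "total x - avg u (total x) = (\<Sum>v\<in>V. Psi v x - avg u (Psi v x))"
    using u by (simp add: total_def avg_sum sum_subtractf)
  then have "nrm (total x - avg u (total x)) \<le> (\<Sum>v\<in>V. nrm (Psi v x - avg u (Psi v x)))"
    by (simp only: op_norm_sum)
  also have "\<dots> \<le> (\<Sum>v\<in>V. (if u = v then 0 else lip x) + (if v \<in> nbhd u then K else 0))"
  proof (rule sum_mono)
    fix v assume v: "v \<in> V"
    \<comment> \<open>By symmetry the sites whose ball contains \<open>u\<close> are those in the
      ball of \<open>u\<close>, so there are at most \<open>N\<close>.\<close>
    have "u \<in> nbhd v \<longleftrightarrow> v \<in> nbhd u"
      using nbhd(5) u v by blast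
    then show "nrm (Psi v x - avg u (Psi v x)) \<le>
        (if u = v then 0 else lip x) + (if v \<in> nbhd u then K else 0)"
      using op_norm_osc_Psi[OF u v x] K unfolding K_def[symmetric]
      by (cases "u = v"; cases "v \<in> nbhd u") simp_all
  qed
  also have "\<dots> = (card V - 1) * lip x + card (nbhd u) * (K)"
  proof -
    have "(\<Sum>v\<in>V. if u = v then 0 else lip x) = (\<Sum>v\<in>V - {u}. lip x)"
      using finite_sites by (intro sum.mono_neutral_cong_right) auto
    moreover have "(\<Sum>v\<in>V. if v \<in> nbhd u then K else 0) =
        (\<Sum>v\<in>nbhd u. K)"
      using finite_sites nbhd(2)[OF u] by (intro sum.mono_neutral_cong_right) auto
    ultimately show ?thesis
      using u finite_sites by (simp add: sum.distrib card_Diff_singleton)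
  qed
  also have "\<dots> \<le> (card V - 1) * lip x + N * (K)"
    using nbhd(4)[OF u] K by (intro add_left_mono mult_right_mono) auto
  also have "\<dots> = (card V - 1 + kappa) * lip x"
    by (simp add: K_def kappa_def power2_eq_square algebra_simps)
  finally show "nrm (total x - avg u (total x)) \<le> (card V - 1 + kappa) * lip x" .
qed

text \<open>With M sites, the scalar factor exp(-M t) meets the bound exp(t (M - 1 +
  \<open>kappa\<close>)) for the series in \<open>total\<close>.\<close>

lemma lip_superop_exp:
  assumes x: "x \<in> ops" and t: "0 \<le> t"
  shows "lip (superop_exp t (heat_bath_generator V d (gibbs_state V d (\<Sum>A\<in>E. h A) \<beta>)) x)
    \<le> exp (- (1 - kappa) * t) * lip x"
proof -
  let ?L = "heat_bath_generator V d (gibbs_state V d (\<Sum>A\<in>E. h A) \<beta>)"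
  define X where "X = (\<lambda>n. op_scale (complex_of_real (t ^ n / fact n)) ((total ^^ n) x))"
  define c where "c = card V - 1 + kappa"
  \<comment> \<open>The subtraction on natural numbers is exact because \<open>V\<close> is
    nonempty.\<close>
  have M: "real (card V - 1) = real (card V) - 1"
    using edges(3) finite_sites by (simp add: of_nat_diff Suc_leI card_gt_0_iff)
  have c: "0 \<le> c"
    using eps_nonneg by (simp add: c_def kappa_def)
  have L: "?L y = total y - op_scale (of_nat (card V)) y" for y
    by (intro ext) (simp add: heat_bath_generator_def total_def sum_fun_apply sum_subtractf op_scale_def)
  have bound: "nrm (total y) \<le> card V * nrm y" if "y \<in> ops" for y
  proof -
    have "nrm (total y) \<le> (\<Sum>v\<in>V. nrm y)"
      unfolding total_def using Psi(2) that by (intro order_trans[OF op_norm_sum] sum_mono)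
    then show ?thesis
      by simp
  qed
  have total_diff: "total (y - z) = total y - total z" if "y \<in> ops" "z \<in> ops" for y z
    unfolding total_def sum_subtractf[symmetric] using that by (intro sum.cong) (auto simp: Psi(3))
  have total_scale: "total (op_scale a y) = op_scale a (total y)" if "y \<in> ops" for a y
    unfolding total_def op_scale_sum using that by (intro sum.cong) (auto simp: Psi(4))
  have X: "abs_summable X" and exp_eq:
    "superop_exp t ?L x = op_scale (complex_of_real (exp (- (real (card V) * t)))) (opsum X)"
    using superop_exp_shift[of ?L total "card V" "card V" x t, OF L total_in_ops bound _ total_diff total_scale x t]
    by (simp_all add: X_def)
  have iter: "(total ^^ n) x \<in> ops \<and> lip ((total ^^ n) x) \<le> c ^ n * lip x" for n
  proof (induction n)
    case (Suc n)
    then have "lip (total ((total ^^ n) x)) \<le> c * lip ((total ^^ n) x)"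
      unfolding c_def by (intro lip_total) auto
    also have "\<dots> \<le> c * (c ^ n * lip x)"
      using Suc c by (intro mult_left_mono) auto
    finally show ?case
      using Suc by (simp add: total_in_ops)
  qed (use x in simp)
  have sums: "(\<lambda>n. \<bar>1 / fact n\<bar> * (t * c) ^ n * lip x) sums (exp (t * c) * lip x)"
    by (intro sums_mult2 exp_coeff_sums)
  have "lip (superop_exp t ?L x) \<le> exp (- (real (card V) * t)) * (exp (t * c) * lip x)"
  proof (rule lip_leI)
    fix v assume v: "v \<in> V"
    \<comment> \<open>Oscillations are taken term by term, where the bound on the iterates of
      \<open>total\<close> applies.\<close>
    define Y where "Y = (\<lambda>n. X n - avg v (X n))"
    have nrm_Y: "nrm (Y n) \<le> \<bar>1 / fact n\<bar> * (t * c) ^ n * lip x" for n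
    proof -
      have "Y n = op_scale (complex_of_real (t ^ n / fact n)) ((total ^^ n) x - avg v ((total ^^ n) x))"
        using v by (simp add: Y_def X_def avg_scale op_scale_diff)
      then have "nrm (Y n) \<le> (t ^ n / fact n) * nrm ((total ^^ n) x - avg v ((total ^^ n) x))"
        using op_norm_scale_le[of "complex_of_real (t ^ n / fact n)"] t
        by (simp add: norm_divide norm_power)
      also have "\<dots> \<le> (t ^ n / fact n) * (c ^ n * lip x)"
        using iter[of n] op_norm_osc_le_lip[OF v, of "(total ^^ n) x"] t by (intro mult_left_mono) auto
      finally show ?thesis
        by (simp add: power_mult_distrib)
    qed
    have "Y n \<in> ops" for n
      using X v by (simp add: Y_def abs_summable_def)
    then have Y: "abs_summable Y"
      by (rule abs_summableI[OF _ nrm_Y sums_summable[OF sums]])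
    have "opsum X - avg v (opsum X) = opsum Y"
    proof (rule opsum_eqI[symmetric])
      have "abs_summable (\<lambda>n. avg v (X n))"
        using X v op_norm_avg[OF v] unfolding abs_summable_def[of X]
        by (intro abs_summableI[of _ "\<lambda>n. nrm (X n)"]) auto
      then show "(\<lambda>n. Y n s u) sums (opsum X - avg v (opsum X)) s u" for s u
        unfolding avg_opsum[OF v X] Y_def minus_apply by (intro sums_diff opsum_sums X)
    qed
    then have bound: "nrm (opsum X - avg v (opsum X)) \<le> exp (t * c) * lip x"
      using op_norm_opsum[OF Y nrm_Y sums_summable[OF sums]] sums_unique[OF sums] by simp
    have "superop_exp t ?L x - avg v (superop_exp t ?L x) =
        op_scale (complex_of_real (exp (- (real (card V) * t)))) (opsum X - avg v (opsum X))"
      using v by (simp add: exp_eq avg_scale op_scale_diff)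
    then have "nrm (superop_exp t ?L x - avg v (superop_exp t ?L x)) \<le>
        exp (- (real (card V) * t)) * nrm (opsum X - avg v (opsum X))"
      using op_norm_scale_le[of "complex_of_real (exp (- (real (card V) * t)))" "opsum X - avg v (opsum X)"]
      by simp
    also have "\<dots> \<le> exp (- (real (card V) * t)) * (exp (t * c) * lip x)"
      by (rule mult_left_mono[OF bound]) simp
    finally show "nrm (superop_exp t ?L x - avg v (superop_exp t ?L x)) \<le>
        exp (- (real (card V) * t)) * (exp (t * c) * lip x)" .
  qed
  also have "\<dots> = exp (- (1 - kappa) * t) * lip x"
    unfolding mult.assoc[symmetric] exp_add[symmetric] c_def M by (simp add: algebra_simps)
  finally show ?thesis .
qed

end

theorem proposition6p1:
  fixes d R N :: nat
  assumes "d \<ge> 1"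
  shows "\<exists>\<beta>\<^sub>c>0. \<forall>\<beta>. 0 < \<beta> \<and> \<beta> < \<beta>\<^sub>c \<longrightarrow>
    (\<exists>\<kappa><1. \<forall>(V :: 'v set) E \<delta> h \<omega>.
       finite_hypergraph V E \<and> finite_range V E \<delta> R N \<and> commuting_interaction V E d h \<and>
       \<omega> = gibbs_state V d (\<Sum>A\<in>E. h A) \<beta> \<longrightarrow>
       (\<forall>x\<in>operators (configs V d). \<forall>t\<ge>0.
          lipschitz_norm V d (superop_exp t (heat_bath_generator V d \<omega>) x)
            \<le> exp (- (1 - \<kappa>) * t) * lipschitz_norm V d x))"
proof -
  \<comment> \<open>This is \<open>kappa\<close> as a function of \<beta>. It involves no other
    datum than \<beta> and \<open>N\<close> and tends to 0 as \<beta> decreases to 0, so the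
    threshold is uniform over all systems.\<close>
  define \<kappa> where "\<kappa> = (\<lambda>\<beta>. 2 * (real N)\<^sup>2 * (exp (\<beta> * 2 ^ N) / (2 - exp (\<beta> * 2 ^ N))\<^sup>2 - 1))"
  have "(\<kappa> \<longlongrightarrow> 2 * (real N)\<^sup>2 * (exp (0 * 2 ^ N) / (2 - exp (0 * 2 ^ N))\<^sup>2 - 1)) (at_right 0)"
    unfolding \<kappa>_def by (intro tendsto_intros) auto
  then have "eventually (\<lambda>\<beta>. \<kappa> \<beta> < 1) (at_right 0)"
    by (rule order_tendstoD) simp
  moreover have "((\<lambda>\<beta>::real. exp (\<beta> * 2 ^ N)) \<longlongrightarrow> exp (0 * 2 ^ N)) (at_right 0)"
    by (intro tendsto_intros)
  then have "eventually (\<lambda>\<beta>::real. exp (\<beta> * 2 ^ N) < 2) (at_right 0)"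
    by (rule order_tendstoD) simp
  ultimately have "eventually (\<lambda>\<beta>. \<kappa> \<beta> < 1 \<and> exp (\<beta> * 2 ^ N) < 2) (at_right 0)"
    by (rule eventually_conj)
  then obtain \<beta>\<^sub>c where \<beta>\<^sub>c: "\<beta>\<^sub>c > 0" "\<And>\<beta>. 0 < \<beta> \<Longrightarrow> \<beta> < \<beta>\<^sub>c \<Longrightarrow> \<kappa> \<beta> < 1 \<and> exp (\<beta> * 2 ^ N) < 2"
    unfolding eventually_at_right_field by auto
  show ?thesis
  proof (rule exI[of _ \<beta>\<^sub>c], intro conjI allI impI \<beta>\<^sub>c(1))
    fix \<beta> assume \<beta>: "0 < \<beta> \<and> \<beta> < \<beta>\<^sub>c"
    show "\<exists>\<kappa><1. \<forall>(V :: 'v set) E \<delta> h \<omega>.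
       finite_hypergraph V E \<and> finite_range V E \<delta> R N \<and> commuting_interaction V E d h \<and>
       \<omega> = gibbs_state V d (\<Sum>A\<in>E. h A) \<beta> \<longrightarrow>
       (\<forall>x\<in>operators (configs V d). \<forall>t\<ge>0.
          lipschitz_norm V d (superop_exp t (heat_bath_generator V d \<omega>) x)
            \<le> exp (- (1 - \<kappa>) * t) * lipschitz_norm V d x)"
    proof (intro exI[of _ "\<kappa> \<beta>"] conjI allI impI ballI)
      show "\<kappa> \<beta> < 1"
        using \<beta>\<^sub>c(2) \<beta> by blast
      fix V :: "'v set" and E \<delta> h \<omega> x and t :: real
      assume sys: "finite_hypergraph V E \<and> finite_range V E \<delta> R N \<and> commuting_interaction V E d h \<and>
        \<omega> = gibbs_state V d (\<Sum>A\<in>E. h A) \<beta>"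
        and x: "x \<in> operators (configs V d)" and t: "0 \<le> t"
      interpret commuting_system V d E \<delta> R N h \<beta>
        by unfold_locales (use sys assms \<beta> \<beta>\<^sub>c(2) in \<open>auto simp: finite_hypergraph_def\<close>)
      show "lipschitz_norm V d (superop_exp t (heat_bath_generator V d \<omega>) x)
          \<le> exp (- (1 - \<kappa> \<beta>) * t) * lipschitz_norm V d x"
        using lip_superop_exp[OF x t] sys by (simp add: \<kappa>_def kappa_def eps_def)
    qed
  qed
qed

end
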